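(* Let $(M,m)$ be a closed weighted Riemannian manifold and let $k\ge1$ be an integer. For any sequence $\{A_\alpha\}_{\alpha=0}^{k}$ of Borel subsets of $M$, we have $$\mathcal{I}_k(M,m)\le\frac{2}{\mathcal{D}(\{A_\alpha\})}\max_{\alpha=0,\dots,k}\log\frac{e\left(1-\sum_{\beta\ne\alpha}m(A_\beta)\right)}{m(A_\alpha)}.$$
   Context: A closed weighted Riemannian manifold $(M,m)$ is a connected compact Riemannian manifold $(M,g)$ without boundary, with Riemannian distance $d$ and Riemannian volume measure $v_g$, together with the probability measure $m=e^{-f}v_g$, where $f\in C^\infty(M)$ satisfies $\int_M e^{-f}\,dv_g=1$. For a Borel set $A\subset M$ put $m^+(A):=\liminf_{r\to0^+}\frac{m(U_r(A))-m(A)}{r}$, where $U_r(A)$ is the open $r$-neighborhood of $A$ in $M$. The $k$-way isoperimetric constant is $$\mathcal{I}_k(M,m):=\inf_{\{A_\alpha\}}\max_{\alpha=0,\dots,k}\frac{m^+(A_\alpha)}{m(A_\alpha)},$$ where the infimum is over all pairwise disjoint sequences $\{A_\alpha\}_{\alpha=0}^{k}$ of non-empty Borel subsets of $M$ (of positive $m$-measure, so that the quotients make sense). $\mathcal{D}(\{A_\alpha\}):=\min_{\alpha\ne\beta}d(A_\alpha,A_\beta)$, with $d(A_\alpha,A_\beta):=\inf\{d(x,y)\mid x\in A_\alpha,\ y\in A_\beta\}$. Convention: if $\mathcal{D}(\{A_\alpha\})=0$ or $m(A_\alpha)=0$ for some $\alpha$, the right-hand side is understood as $+\infty$. $\log$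 is the natural logarithm. *)

theory Defs
  imports "HOL-Analysis.Analysis"
begin

section \<open>Smooth functions on open subsets of normed spaces\<close>

primrec Ck_on :: "nat \<Rightarrow> 'a::real_normed_vector set \<Rightarrow> ('a \<Rightarrow> 'b::real_normed_vector) \<Rightarrow> bool" where
  "Ck_on 0 S h \<longleftrightarrow> continuous_on S h"
| "Ck_on (Suc n) S h \<longleftrightarrow> (\<forall>x\<in>S. h differentiable (at x)) \<and>
     (\<forall>w. Ck_on n S (\<lambda>x. frechet_derivative h (at x) w))"

definition smooth_on :: "'a::real_normed_vector set \<Rightarrow> ('a \<Rightarrow> 'b::real_normed_vector) \<Rightarrow> bool" where
  "smooth_on S h \<longleftrightarrow> (\<forall>n. Ck_on n S h)"


section \<open>Closed manifolds\<close>

text \<open>A manifold is the whole type \<open>'a\<close> together with an atlas of charts \<open>(U, \<phi>)\<close>. The values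
  of \<open>\<phi>\<close> outside \<open>U\<close> are irrelevant. The atlas need not be maximal.\<close>

type_synonym ('a, 'n) chart = "'a set \<times> ('a \<Rightarrow> real^'n)"

abbreviation chart_dom :: "('a, 'n) chart \<Rightarrow> 'a set" where
  "chart_dom c \<equiv> fst c"

abbreviation chart_map :: "('a, 'n) chart \<Rightarrow> 'a \<Rightarrow> real^'n" where
  "chart_map c \<equiv> snd c"

abbreviation chart_image :: "('a, 'n) chart \<Rightarrow> (real^'n) set" where
  "chart_image c \<equiv> chart_map c ` chart_dom c"

definition chart_inv :: "('a, 'n) chart \<Rightarrow> real^'n \<Rightarrow> 'a" where
  "chart_inv c = inv_into (chart_dom c) (chart_map c)"

definition is_chart :: "('a::topological_space, 'n::finite) chart \<Rightarrow> bool" where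
  "is_chart c \<longleftrightarrow> open (chart_dom c) \<and> open (chart_image c) \<and>
     homeomorphism (chart_dom c) (chart_image c) (chart_map c) (chart_inv c)"

definition transition :: "('a, 'n) chart \<Rightarrow> ('a, 'n) chart \<Rightarrow> real^'n \<Rightarrow> real^'n" where
  "transition c c' = chart_map c' \<circ> chart_inv c"

definition smooth_atlas :: "('a::topological_space, 'n::finite) chart set \<Rightarrow> bool" where
  "smooth_atlas \<A> \<longleftrightarrow>
     (\<forall>c\<in>\<A>. is_chart c) \<and> (\<Union>c\<in>\<A>. chart_dom c) = UNIV \<and>
     (\<forall>c\<in>\<A>. \<forall>c'\<in>\<A>. smooth_on (chart_map c ` (chart_dom c \<inter> chart_dom c')) (transition c c'))"

definition smooth_function :: "('a, 'n::finite) chart set \<Rightarrow> ('a \<Rightarrow> real) \<Rightarrow> bool" where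
  "smooth_function \<A> f \<longleftrightarrow> (\<forall>c\<in>\<A>. smooth_on (chart_image c) (f \<circ> chart_inv c))"


section \<open>Riemannian metrics\<close>

text \<open>For a chart \<open>c\<close> and a point \<open>p\<close> of its domain, \<open>g c p v w\<close> is the Riemannian inner product
  of the two tangent vectors at \<open>p\<close> whose coordinates with respect to \<open>c\<close> are \<open>v\<close> and \<open>w\<close>. The
  last clause is the transformation law of covariant 2-tensors, so that the local expressions
  define one tensor field.\<close>

type_synonym ('a, 'n) metric = "('a, 'n) chart \<Rightarrow> 'a \<Rightarrow> real^'n \<Rightarrow> real^'n \<Rightarrow> real"

definition riemannian_metric :: "('a, 'n::finite) chart set \<Rightarrow> ('a, 'n) metric \<Rightarrow> bool" where
  "riemannian_metric \<A> g \<longleftrightarrow>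
     (\<forall>c\<in>\<A>. \<forall>p\<in>chart_dom c. bilinear (g c p) \<and> (\<forall>v w. g c p v w = g c p w v) \<and>
        (\<forall>v. v \<noteq> 0 \<longrightarrow> g c p v v > 0)) \<and>
     (\<forall>c\<in>\<A>. \<forall>v w. smooth_on (chart_image c) (\<lambda>x. g c (chart_inv c x) v w)) \<and>
     (\<forall>c\<in>\<A>. \<forall>c'\<in>\<A>. \<forall>p\<in>chart_dom c \<inter> chart_dom c'. \<forall>v w.
        (let T = frechet_derivative (transition c c') (at (chart_map c p))
         in g c p v w = g c' p (T v) (T w)))"


section \<open>Riemannian distance\<close>

definition C1_curve_on ::
    "('a::topological_space, 'n::finite) chart set \<Rightarrow> real \<Rightarrow> real \<Rightarrow> (real \<Rightarrow> 'a) \<Rightarrow> bool" where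
  "C1_curve_on \<A> a b \<gamma> \<longleftrightarrow> continuous_on {a..b} \<gamma> \<and>
     (\<forall>c\<in>\<A>. \<exists>D. continuous_on ({a..b} \<inter> \<gamma> -` chart_dom c) D \<and>
        (\<forall>t\<in>{a..b} \<inter> \<gamma> -` chart_dom c.
           ((chart_map c \<circ> \<gamma>) has_vector_derivative D t) (at t within {a..b})))"

definition piecewise_C1_curve ::
    "('a::topological_space, 'n::finite) chart set \<Rightarrow> (real \<Rightarrow> 'a) \<Rightarrow> bool" where
  "piecewise_C1_curve \<A> \<gamma> \<longleftrightarrow> continuous_on {0..1} \<gamma> \<and>
     (\<exists>S. finite S \<and>
        (\<forall>a b. 0 \<le> a \<and> a < b \<and> b \<le> 1 \<and> {a<..<b} \<inter> S = {} \<longrightarrow> C1_curve_on \<A> a b \<gamma>))"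

text \<open>By the transformation law, the speed does not depend on the choice of the chart. It is
  meaningless at the finitely many break points of a piecewise \<open>C\<^sup>1\<close> curve, which do not
  contribute to the length.\<close>

definition curve_speed :: "('a, 'n::finite) chart set \<Rightarrow> ('a, 'n) metric \<Rightarrow> (real \<Rightarrow> 'a) \<Rightarrow> real \<Rightarrow> real" where
  "curve_speed \<A> g \<gamma> t =
     (let c = (SOME c. c \<in> \<A> \<and> \<gamma> t \<in> chart_dom c);
          v = vector_derivative (chart_map c \<circ> \<gamma>) (at t)
      in sqrt (g c (\<gamma> t) v v))"

definition curve_length :: "('a, 'n::finite) chart set \<Rightarrow> ('a, 'n) metric \<Rightarrow> (real \<Rightarrow> 'a) \<Rightarrow> ennreal" where
  "curve_length \<A> g \<gamma> = (\<integral>\<^sup>+t\<in>{0..1}. ennreal (curve_speed \<A> g \<gamma> t) \<partial>lborel)"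

text \<open>The distance is an extended real, with the infimum of the empty set being \<open>\<infinity>\<close>. On a connected
  manifold any two points are joined by a piecewise \<open>C\<^sup>1\<close> curve, so the value \<open>\<infinity>\<close> does not
  occur there.\<close>

definition riemannian_dist ::
    "('a::topological_space, 'n::finite) chart set \<Rightarrow> ('a, 'n) metric \<Rightarrow> 'a \<Rightarrow> 'a \<Rightarrow> ennreal" where
  "riemannian_dist \<A> g x y =
     (INF \<gamma>\<in>{\<gamma>. piecewise_C1_curve \<A> \<gamma> \<and> \<gamma> 0 = x \<and> \<gamma> 1 = y}. curve_length \<A> g \<gamma>)"

definition nbhd ::
    "('a::topological_space, 'n::finite) chart set \<Rightarrow> ('a, 'n) metric \<Rightarrow> real \<Rightarrow> 'a set \<Rightarrow> 'a set" where
  "nbhd \<A> g r A = {x. \<exists>a\<in>A. riemannian_dist \<A> g a x < ennreal r}"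

definition set_distance ::
    "('a::topological_space, 'n::finite) chart set \<Rightarrow> ('a, 'n) metric \<Rightarrow> 'a set \<Rightarrow> 'a set \<Rightarrow> ennreal" where
  "set_distance \<A> g A B = (INF x\<in>A. INF y\<in>B. riemannian_dist \<A> g x y)"


section \<open>Riemannian volume measure\<close>

definition gram_matrix :: "('a, 'n::finite) metric \<Rightarrow> ('a, 'n) chart \<Rightarrow> 'a \<Rightarrow> real^'n^'n" where
  "gram_matrix g c p = (\<chi> i j. g c p (axis i 1) (axis j 1))"

definition riemannian_volume ::
    "('a::topological_space, 'n::finite) chart set \<Rightarrow> ('a, 'n) metric \<Rightarrow> 'a measure \<Rightarrow> bool" where
  "riemannian_volume \<A> g v \<longleftrightarrow> sets v = sets borel \<and>
     (\<forall>c\<in>\<A>. \<forall>A\<in>sets borel. A \<subseteq> chart_dom c \<longrightarrow>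
        emeasure v A =
          (\<integral>\<^sup>+x\<in>chart_map c ` A. ennreal (sqrt (det (gram_matrix g c (chart_inv c x)))) \<partial>lborel))"

text \<open>The Riemannian volume measure is thereby uniquely determined.\<close>

lemma riemannian_volume_unique:
  fixes \<A> :: "('a::topological_space, 'n::finite) chart set"
  assumes cpt: "compact (UNIV :: 'a set)" and at: "smooth_atlas \<A>"
    and v: "riemannian_volume \<A> g v" and w: "riemannian_volume \<A> g w"
  shows "v = w"
proof (rule measure_eqI)
  show sets_eq: "sets v = sets w"
    using v w by (simp add: riemannian_volume_def)
  fix A assume "A \<in> sets v"
  then have A: "A \<in> sets borel"
    using v by (simp add: riemannian_volume_def)
  have op: "open (chart_dom c)" if "c \<in> \<A>" for c
    using at that by (auto simp: smooth_atlas_def is_chart_def)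
  have cover: "UNIV \<subseteq> (\<Union>c\<in>\<A>. chart_dom c)"
    using at by (simp add: smooth_atlas_def)
  obtain F where F: "F \<subseteq> \<A>" "finite F" "UNIV \<subseteq> (\<Union>c\<in>F. chart_dom c)"
    using compactE_image[OF cpt op cover] by blast
  have "emeasure v B = emeasure w B" if "B \<in> sets borel" "B \<subseteq> (\<Union>c\<in>F. chart_dom c)" for B
    using F(2,1) that
  proof (induction F arbitrary: B rule: finite_induct)
    case empty
    then show ?case by simp
  next
    case (insert c F)
    have U: "chart_dom c \<in> sets borel"
      using op insert.prems by auto
    have in_sets: "B \<inter> chart_dom c \<in> sets borel" "B - chart_dom c \<in> sets borel"
      using U insert.prems by auto
    have split: "emeasure u B = emeasure u (B \<inter> chart_dom c) + emeasure u (B - chart_dom c)"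
      if "sets u = sets borel" for u
    proof -
      have "emeasure u (B \<inter> chart_dom c) + emeasure u (B - chart_dom c)
          = emeasure u ((B \<inter> chart_dom c) \<union> (B - chart_dom c))"
        by (rule plus_emeasure) (use that in_sets in auto)
      also have "(B \<inter> chart_dom c) \<union> (B - chart_dom c) = B" by blast
      finally show ?thesis by simp
    qed
    have "emeasure v (B \<inter> chart_dom c) = emeasure w (B \<inter> chart_dom c)"
    proof -
      have "c \<in> \<A>" "B \<inter> chart_dom c \<subseteq> chart_dom c"
        using insert.prems by auto
      then show ?thesis
        using v w in_sets(1) unfolding riemannian_volume_def by presburger
    qed
    moreover have "emeasure v (B - chart_dom c) = emeasure w (B - chart_dom c)"
      by (rule insert.IH) (use in_sets insert.prems in auto)
    ultimately show ?case
      using split[of v] split[of w] v w by (simp add: riemannian_volume_def)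
  qed
  then show "emeasure v A = emeasure w A"
    using A F(3) by blast
qed


section \<open>Closed weighted Riemannian manifolds\<close>

text \<open>Here \<open>v\<close> is the Riemannian volume measure \<open>v\<^sub>g\<close>; it is carried along as an argument, which is
  harmless because \<open>v\<close> is determined by \<open>\<A>\<close> and \<open>g\<close>.\<close>

definition closed_weighted_riemannian_manifold ::
    "('a::{t2_space, second_countable_topology}, 'n::finite) chart set \<Rightarrow> ('a, 'n) metric \<Rightarrow>
      'a measure \<Rightarrow> ('a \<Rightarrow> real) \<Rightarrow> bool" where
  "closed_weighted_riemannian_manifold \<A> g v f \<longleftrightarrow>
     compact (UNIV :: 'a set) \<and> connected (UNIV :: 'a set) \<and>
     smooth_atlas \<A> \<and> riemannian_metric \<A> g \<and> riemannian_volume \<A> g v \<and>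
     smooth_function \<A> f \<and> (\<integral>x. exp (- f x) \<partial>v) = 1"

definition weighted_measure :: "'a measure \<Rightarrow> ('a \<Rightarrow> real) \<Rightarrow> 'a measure" where
  "weighted_measure v f = density v (\<lambda>x. ennreal (exp (- f x)))"


section \<open>Isoperimetric constants and separation of sequences of sets\<close>

definition boundary_measure ::
    "('a::topological_space, 'n::finite) chart set \<Rightarrow> ('a, 'n) metric \<Rightarrow> 'a measure \<Rightarrow> 'a set \<Rightarrow> ereal" where
  "boundary_measure \<A> g m A =
     Liminf (at_right 0) (\<lambda>r. ereal ((measure m (nbhd \<A> g r A) - measure m A) / r))"

definition isoperimetric_constant ::
    "('a::topological_space, 'n::finite) chart set \<Rightarrow> ('a, 'n) metric \<Rightarrow> 'a measure \<Rightarrow> nat \<Rightarrow> ereal" where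
  "isoperimetric_constant \<A> g m k =
     (INF A\<in>{A :: nat \<Rightarrow> 'a set.
               (\<forall>\<alpha>\<le>k. A \<alpha> \<in> sets borel \<and> A \<alpha> \<noteq> {} \<and> measure m (A \<alpha>) > 0) \<and>
               disjoint_family_on A {..k}}.
        MAX \<alpha>\<in>{..k}. boundary_measure \<A> g m (A \<alpha>) / ereal (measure m (A \<alpha>)))"

definition separation ::
    "('a::topological_space, 'n::finite) chart set \<Rightarrow> ('a, 'n) metric \<Rightarrow> nat \<Rightarrow> (nat \<Rightarrow> 'a set) \<Rightarrow> ennreal" where
  "separation \<A> g k A =
     (MIN (\<alpha>, \<beta>)\<in>{(\<alpha>, \<beta>). \<alpha> \<le> k \<and> \<beta> \<le> k \<and> \<alpha> \<noteq> \<beta>}. set_distance \<A> g (A \<alpha>) (A \<beta>))"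

end

theory Submission
  imports Defs "HOL-Probability.Probability_Measure"
begin

text \<open>Let \<open>D\<close> be the separation of the sets \<open>A\<^sub>\<alpha>\<close> and \<open>L\<close> the maximum of the logarithms. The sets are
  enlarged to open neighbourhoods \<open>U\<^sub>r(A\<^sub>\<alpha>)\<close> with \<open>r < D / 2\<close>, where the radius may depend on \<open>\<alpha>\<close>. By
  the triangle inequality they stay pairwise disjoint, so every choice of radii yields a competitor
  for the isoperimetric constant \<open>I\<close>. Suppose \<open>I > c' > 2 L / D\<close>. For every choice of radii, at least
  one neighbourhood then satisfies \<open>m\<^sup>+(U) > c' m(U)\<close>. Since the radii vary independently, a single
  index \<open>\<alpha>\<close> must have this property for all radii in \<open>(0, D / 2)\<close>; otherwise one could pick a failing
  radius for every index. This is why the maximum over \<open>\<alpha>\<close>, and not a sum, appears in the bound.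

  For this \<open>\<alpha>\<close> the inclusion \<open>U\<^sub>s(U\<^sub>r(A)) \<subseteq> U\<^sub>r\<^sub>+\<^sub>s(A)\<close> turns the isoperimetric inequality into the
  differential inequality \<open>F' \<ge> c' F\<close> for \<open>F(r) = m(U\<^sub>r(A\<^sub>\<alpha>))\<close>, in the sense of lower right derivatives,
  and \<open>F\<close> grows exponentially (\<open>exponential_growth\<close>, \<open>measure_nbhd_growth\<close>). Before the radius reaches
  \<open>D / 2\<close> it reaches \<open>m(A\<^sub>\<alpha>) exp L\<close>, which is more than the measure \<open>1 - \<Sum>\<^sub>\<beta> m(A\<^sub>\<beta>)\<close>, \<open>\<beta> \<noteq> \<alpha>\<close>, available
  outside the other sets (\<open>isoperimetric_constant_le\<close>).

  The geometric input is that the Riemannian distance is symmetric, satisfies the triangle inequality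
  and has open neighbourhoods. The first two follow from reversing and joining curves
  (\<open>curve_length_reversepath\<close>, \<open>curve_length_joinpaths\<close>), which requires the speed to be independent
  of the chart and measurable; the third from short coordinate segments
  (\<open>riemannian_dist_locally_small\<close>).\<close>

section \<open>Charts and the metric tensor\<close>

locale riemannian_atlas =
  fixes \<A> :: "('a::topological_space, 'n::finite) chart set" and g :: "('a, 'n) metric"
  assumes atlas: "smooth_atlas \<A>" and metric: "riemannian_metric \<A> g"
begin

lemma chart_dom_open: "c \<in> \<A> \<Longrightarrow> open (chart_dom c)"
  using atlas by (auto simp: smooth_atlas_def is_chart_def)

lemma chart_image_open: "c \<in> \<A> \<Longrightarrow> open (chart_image c)"
  using atlas by (auto simp: smooth_atlas_def is_chart_def)

lemma chart_homeomorphism: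
  "c \<in> \<A> \<Longrightarrow> homeomorphism (chart_dom c) (chart_image c) (chart_map c) (chart_inv c)"
  using atlas by (auto simp: smooth_atlas_def is_chart_def)

lemma chart_inv_map [simp]: "c \<in> \<A> \<Longrightarrow> p \<in> chart_dom c \<Longrightarrow> chart_inv c (chart_map c p) = p"
  using chart_homeomorphism by (auto simp: homeomorphism_def)

lemma chart_map_inv [simp]: "c \<in> \<A> \<Longrightarrow> x \<in> chart_image c \<Longrightarrow> chart_map c (chart_inv c x) = x"
  using chart_homeomorphism by (auto simp: homeomorphism_def)

lemma chart_inv_in_dom: "c \<in> \<A> \<Longrightarrow> x \<in> chart_image c \<Longrightarrow> chart_inv c x \<in> chart_dom c"
  using chart_homeomorphism by (auto simp: homeomorphism_def)

lemma chart_at: obtains c where "c \<in> \<A>" "p \<in> chart_dom c"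
  using atlas UNIV_I[of p] unfolding smooth_atlas_def by blast

lemma chosen_chart:
  "(SOME c. c \<in> \<A> \<and> p \<in> chart_dom c) \<in> \<A>"
  "p \<in> chart_dom (SOME c. c \<in> \<A> \<and> p \<in> chart_dom c)"
proof -
  have "\<exists>c. c \<in> \<A> \<and> p \<in> chart_dom c" using chart_at by blast
  from someI_ex[OF this] show "(SOME c. c \<in> \<A> \<and> p \<in> chart_dom c) \<in> \<A>"
    "p \<in> chart_dom (SOME c. c \<in> \<A> \<and> p \<in> chart_dom c)" by auto
qed

lemma transition_Ck:
  "c \<in> \<A> \<Longrightarrow> c' \<in> \<A> \<Longrightarrow> Ck_on n (chart_map c ` (chart_dom c \<inter> chart_dom c')) (transition c c')"
  using atlas by (auto simp: smooth_atlas_def smooth_on_def)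

lemma transition_has_derivative:
  assumes "c \<in> \<A>" "c' \<in> \<A>" "p \<in> chart_dom c" "p \<in> chart_dom c'"
  shows "(transition c c' has_derivative frechet_derivative (transition c c') (at (chart_map c p)))
           (at (chart_map c p))"
proof -
  have "transition c c' differentiable at (chart_map c p)"
    using transition_Ck[OF assms(1,2), of "Suc 0"] assms(3,4) by auto
  then show ?thesis by (simp add: frechet_derivative_works)
qed

lemma transition_derivative_continuous:
  assumes "c \<in> \<A>" "c' \<in> \<A>"
  shows "continuous_on (chart_map c ` (chart_dom c \<inter> chart_dom c'))
           (\<lambda>x. frechet_derivative (transition c c') (at x) w)"
  using transition_Ck[OF assms, of "Suc 0"] by auto

lemma metric_bilinear: "c \<in> \<A> \<Longrightarrow> p \<in> chart_dom c \<Longrightarrow> bilinear (g c p)"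
  using metric unfolding riemannian_metric_def by blast

lemma metric_transform:
  assumes "c \<in> \<A>" "c' \<in> \<A>" "p \<in> chart_dom c" "p \<in> chart_dom c'"
  shows "g c p v w = g c' p (frechet_derivative (transition c c') (at (chart_map c p)) v)
                            (frechet_derivative (transition c c') (at (chart_map c p)) w)"
  using metric assms unfolding riemannian_metric_def Let_def by blast

text \<open>Smoothness of the metric gives continuity of \<open>g v w\<close> in the base point for fixed \<open>v\<close>, \<open>w\<close>
  only. Joint continuity follows by bilinearity, expanding \<open>v\<close> in the finite standard basis.\<close>

lemma metric_continuous:
  assumes c: "c \<in> \<A>"
  shows "continuous_on (chart_image c \<times> UNIV) (\<lambda>(x, v). g c (chart_inv c x) v v)"
proof -
  have cont: "continuous_on (chart_image c) (\<lambda>x. g c (chart_inv c x) v w)" for v w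
  proof -
    have "smooth_on (chart_image c) (\<lambda>x. g c (chart_inv c x) v w)"
      using metric c unfolding riemannian_metric_def by blast
    then have "Ck_on 0 (chart_image c) (\<lambda>x. g c (chart_inv c x) v w)"
      unfolding smooth_on_def by blast
    then show ?thesis by simp
  qed
  have expand: "g c (chart_inv c x) v v =
      (\<Sum>(i, j)\<in>Basis \<times> Basis. (v \<bullet> i) * ((v \<bullet> j) * g c (chart_inv c x) i j))"
    if "x \<in> chart_image c" for x v
  proof -
    let ?h = "g c (chart_inv c x)"
    have b: "bilinear ?h" using metric_bilinear[OF c chart_inv_in_dom[OF c that]] .
    have "?h (\<Sum>i\<in>Basis. (v \<bullet> i) *\<^sub>R i) (\<Sum>i\<in>Basis. (v \<bullet> i) *\<^sub>R i) =
       (\<Sum>(i, j)\<in>Basis \<times> Basis. (v \<bullet> i) * ((v \<bullet> j) * ?h i j))"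
      by (subst bilinear_sum[OF b])
         (simp add: bilinear_lmul[OF b] bilinear_rmul[OF b] mult.left_commute)
    then show ?thesis by (simp add: euclidean_representation)
  qed
  have "continuous_on (chart_image c \<times> UNIV)
     (\<lambda>z. \<Sum>(i, j)\<in>Basis \<times> Basis. (snd z \<bullet> i) * ((snd z \<bullet> j) * g c (chart_inv c (fst z)) i j))"
    unfolding case_prod_beta
    by (intro continuous_intros continuous_on_compose2[OF cont]) auto
  then show ?thesis
    by (rule continuous_on_eq) (auto simp: expand)
qed

lemma metric_continuous_compose:
  assumes "c \<in> \<A>" "continuous_on T h" "continuous_on T D" "h ` T \<subseteq> chart_dom c"
  shows "continuous_on T (\<lambda>t. g c (h t) (D t) (D t))"
proof -
  have "continuous_on (chart_dom c) (chart_map c)"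
    using chart_homeomorphism[OF assms(1)] by (auto simp: homeomorphism_def)
  then have 1: "continuous_on T (\<lambda>t. chart_map c (h t))"
    using assms by (auto intro: continuous_on_compose2)
  have "continuous_on T (\<lambda>t. (\<lambda>(x, v). g c (chart_inv c x) v v) (chart_map c (h t), D t))"
    by (rule continuous_on_compose2[OF metric_continuous[OF assms(1)]])
       (use assms 1 in \<open>auto intro!: continuous_intros\<close>)
  then show ?thesis
    by (rule continuous_on_eq) (use assms in auto)
qed

section \<open>Speed of curves\<close>

text \<open>The chain rule applied to \<open>c' \<circ> \<gamma> = transition c c' \<circ> (c \<circ> \<gamma>)\<close>, an identity that continuity of
  \<open>\<gamma>\<close> guarantees near \<open>t\<close>.\<close>

lemma transition_compose_derivative:
  assumes c: "c \<in> \<A>" and c': "c' \<in> \<A>" and p: "\<gamma> t \<in> chart_dom c" "\<gamma> t \<in> chart_dom c'"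
    and d: "((chart_map c \<circ> \<gamma>) has_vector_derivative v) (at t within T)"
    and cont: "continuous (at t within T) \<gamma>" and t: "t \<in> T"
  shows "((chart_map c' \<circ> \<gamma>) has_vector_derivative
           frechet_derivative (transition c c') (at (chart_map c (\<gamma> t))) v) (at t within T)"
proof -
  let ?T = "frechet_derivative (transition c c') (at (chart_map c (\<gamma> t)))"
  have lin: "linear ?T"
    using transition_has_derivative[OF c c' p] has_derivative_linear by blast
  have "((transition c c' \<circ> (chart_map c \<circ> \<gamma>)) has_derivative ?T \<circ> (\<lambda>h. h *\<^sub>R v)) (at t within T)"
    by (rule diff_chain_within)
       (use d transition_has_derivative[OF c c' p] in
        \<open>auto simp: has_vector_derivative_def intro: has_derivative_at_withinI\<close>)
  then have "((transition c c' \<circ> (chart_map c \<circ> \<gamma>)) has_vector_derivative ?T v) (at t within T)"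
    by (simp add: has_vector_derivative_def o_def linear_scale[OF lin])
  moreover have "eventually (\<lambda>s. \<gamma> s \<in> chart_dom c) (at t within T)"
    using cont chart_dom_open[OF c] p(1) unfolding continuous_within
    by (rule topological_tendstoD)
  then have "eventually (\<lambda>s. (transition c c' \<circ> (chart_map c \<circ> \<gamma>)) s = (chart_map c' \<circ> \<gamma>) s) (at t within T)"
    by eventually_elim (use c in \<open>auto simp: transition_def\<close>)
  ultimately show ?thesis
    unfolding has_vector_derivative_def
    by (rule has_derivative_transform_eventually) (use c p t in \<open>auto simp: transition_def\<close>)
qed

text \<open>Velocities in two charts differ by the derivative of the transition map, and the metric
  transforms so as to compensate for this. Hence the arbitrary chart chosen in the definition of the speed may
  be replaced by any chart around the point.\<close>

lemma curve_speed_in_chart: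
  assumes c: "c \<in> \<A>" and p: "\<gamma> t \<in> chart_dom c"
    and d: "((chart_map c \<circ> \<gamma>) has_vector_derivative v) (at t)" and cont: "isCont \<gamma> t"
  shows "curve_speed \<A> g \<gamma> t = sqrt (g c (\<gamma> t) v v)"
proof -
  define c' where "c' = (SOME c. c \<in> \<A> \<and> \<gamma> t \<in> chart_dom c)"
  have c': "c' \<in> \<A>" "\<gamma> t \<in> chart_dom c'" unfolding c'_def by (rule chosen_chart)+
  have "vector_derivative (chart_map c' \<circ> \<gamma>) (at t)
      = frechet_derivative (transition c c') (at (chart_map c (\<gamma> t))) v"
    using transition_compose_derivative[OF c c'(1) p c'(2) d cont]
    by (intro vector_derivative_at) auto
  then show ?thesis
    unfolding curve_speed_def Let_def c'_def[symmetric]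
    using metric_transform[OF c c'(1) p c'(2)] by simp
qed

text \<open>The times at which a piecewise \<open>C\<^sup>1\<close> curve has a two-sided derivative that is continuous nearby.
  All but finitely many times in the unit interval are of this kind.\<close>

definition regular_at :: "(real \<Rightarrow> 'a) \<Rightarrow> real \<Rightarrow> bool" where
  "regular_at \<gamma> t \<longleftrightarrow> (\<exists>a b. a < t \<and> t < b \<and> C1_curve_on \<A> a b \<gamma>)"

text \<open>The continuity of the speed is what makes the integrand of the length measurable: the chart in
  the definition of the speed is chosen separately at every time, so measurability is not visible
  from the definition.\<close>

lemma regular_atD:
  assumes "regular_at \<gamma> t"
  shows "isCont \<gamma> t"
    and "c \<in> \<A> \<Longrightarrow> \<gamma> t \<in> chart_dom c \<Longrightarrow> \<exists>v. ((chart_map c \<circ> \<gamma>) has_vector_derivative v) (at t)"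
    and "isCont (curve_speed \<A> g \<gamma>) t"
proof -
  obtain a b where ab: "a < t" "t < b" "C1_curve_on \<A> a b \<gamma>"
    using assms by (auto simp: regular_at_def)
  have cont: "continuous_on {a<..<b} \<gamma>"
    using ab(3) by (auto simp: C1_curve_on_def intro: continuous_on_subset)
  show "isCont \<gamma> t"
    using cont ab by (auto simp: continuous_on_eq_continuous_at)
  have der: "\<exists>D. continuous_on ({a..b} \<inter> \<gamma> -` chart_dom c) D \<and>
      (\<forall>t\<in>{a<..<b} \<inter> \<gamma> -` chart_dom c. ((chart_map c \<circ> \<gamma>) has_vector_derivative D t) (at t))"
    if "c \<in> \<A>" for c
  proof -
    obtain D where D: "continuous_on ({a..b} \<inter> \<gamma> -` chart_dom c) D"
      "\<forall>t\<in>{a..b} \<inter> \<gamma> -` chart_dom c.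
           ((chart_map c \<circ> \<gamma>) has_vector_derivative D t) (at t within {a..b})"
      using ab(3) \<open>c \<in> \<A>\<close> unfolding C1_curve_on_def by meson
    have "((chart_map c \<circ> \<gamma>) has_vector_derivative D t) (at t)"
      if "t\<in>{a<..<b} \<inter> \<gamma> -` chart_dom c" for t
      using D(2)[rule_format, of t] that by (simp add: at_within_Icc_at)
    with D(1) show ?thesis by blast
  qed
  show "\<exists>v. ((chart_map c \<circ> \<gamma>) has_vector_derivative v) (at t)"
    if "c \<in> \<A>" "\<gamma> t \<in> chart_dom c"
    using der[OF that(1)] that ab by auto
  obtain c where c: "c \<in> \<A>" "\<gamma> t \<in> chart_dom c" using chart_at .
  obtain D where D: "continuous_on ({a..b} \<inter> \<gamma> -` chart_dom c) D"
    "\<And>t. t\<in>{a<..<b} \<inter> \<gamma> -` chart_dom c \<Longrightarrow> ((chart_map c \<circ> \<gamma>) has_vector_derivative D t) (at t)"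
    using der[OF c(1)] by blast
  let ?W = "{a<..<b} \<inter> \<gamma> -` chart_dom c"
  have W: "open ?W"
    using continuous_on_open_vimage[OF open_greaterThanLessThan] cont chart_dom_open[OF c(1)]
    by (metis Int_commute)
  have "continuous_on ?W (\<lambda>s. sqrt (g c (\<gamma> s) (D s) (D s)))"
    by (intro continuous_intros metric_continuous_compose[OF c(1)])
       (use cont D(1) in \<open>auto intro: continuous_on_subset\<close>)
  then have "continuous_on ?W (curve_speed \<A> g \<gamma>)"
  proof (rule continuous_on_eq)
    fix s assume s: "s \<in> ?W"
    have "isCont \<gamma> s" using s cont by (auto simp: continuous_on_eq_continuous_at)
    then show "sqrt (g c (\<gamma> s) (D s) (D s)) = curve_speed \<A> g \<gamma> s"
      using curve_speed_in_chart[OF c(1) _ D(2)[OF s]] s by auto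
  qed
  then show "isCont (curve_speed \<A> g \<gamma>) t"
    using W ab c by (auto simp: continuous_on_eq_continuous_at)
qed

lemma curve_speed_affine:
  assumes reg: "regular_at \<gamma> (q + p * t)"
    and eq: "eventually (\<lambda>s. \<delta> s = \<gamma> (q + p * s)) (nhds t)"
  shows "curve_speed \<A> g \<delta> t = \<bar>p\<bar> * curve_speed \<A> g \<gamma> (q + p * t)"
proof -
  let ?u = "q + p * t"
  obtain c where c: "c \<in> \<A>" "\<gamma> ?u \<in> chart_dom c" using chart_at .
  obtain v where v: "((chart_map c \<circ> \<gamma>) has_vector_derivative v) (at ?u)"
    using regular_atD(2)[OF reg c] by blast
  have dt: "\<delta> t = \<gamma> ?u" using eq by (rule eventually_nhds_x_imp_x)
  have "((\<lambda>s. q + p * s) has_vector_derivative p) (at t)"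
    by (auto intro!: derivative_eq_intros simp: has_real_derivative_iff_has_vector_derivative[symmetric])
  from vector_diff_chain_at[OF this v]
  have "((chart_map c \<circ> \<gamma> \<circ> (\<lambda>s. q + p * s)) has_vector_derivative p *\<^sub>R v) (at t)" .
  moreover have "eventually (\<lambda>s. (chart_map c \<circ> \<gamma> \<circ> (\<lambda>s. q + p * s)) s = (chart_map c \<circ> \<delta>) s) (nhds t)"
    using eq by eventually_elim simp
  ultimately have d: "((chart_map c \<circ> \<delta>) has_vector_derivative p *\<^sub>R v) (at t)"
    using has_vector_derivative_cong_ev by (smt (verit) UNIV_I eventually_mono eventually_nhds_x_imp_x)
  have "isCont (\<lambda>s. \<gamma> (q + p * s)) t"
    by (rule isCont_o2[where f="\<lambda>s. q + p * s" and g=\<gamma>])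
       (auto intro!: continuous_intros regular_atD(1)[OF reg])
  then have "isCont \<delta> t" using isCont_cong[OF eq] by simp
  then have "curve_speed \<A> g \<delta> t = sqrt (g c (\<gamma> ?u) (p *\<^sub>R v) (p *\<^sub>R v))"
    using curve_speed_in_chart[OF c(1) _ d] dt c by simp
  also have "g c (\<gamma> ?u) (p *\<^sub>R v) (p *\<^sub>R v) = p\<^sup>2 * g c (\<gamma> ?u) v v"
    using metric_bilinear[OF c] by (simp add: bilinear_lmul bilinear_rmul power2_eq_square)
  also have "sqrt (p\<^sup>2 * g c (\<gamma> ?u) v v) = \<bar>p\<bar> * curve_speed \<A> g \<gamma> ?u"
    using curve_speed_in_chart[where \<gamma>=\<gamma>, OF c v regular_atD(1)[OF reg]] by (simp add: real_sqrt_mult)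
  finally show ?thesis .
qed

lemma piecewise_C1_regular:
  assumes "piecewise_C1_curve \<A> \<gamma>"
  obtains S where "finite S" "\<And>t. t \<in> {0<..<1} - S \<Longrightarrow> regular_at \<gamma> t"
proof -
  obtain S where S: "finite S"
    "\<And>a b. 0 \<le> a \<Longrightarrow> a < b \<Longrightarrow> b \<le> 1 \<Longrightarrow> {a<..<b} \<inter> S = {} \<Longrightarrow> C1_curve_on \<A> a b \<gamma>"
    using assms unfolding piecewise_C1_curve_def by blast
  have "regular_at \<gamma> t" if t: "t \<in> {0<..<1} - S" for t
  proof -
    have "open ({0<..<1} - S)" using S(1) by (simp add: finite_imp_closed open_Diff)
    then obtain e where e: "e > 0" "cball t e \<subseteq> {0<..<1} - S"
      using t open_contains_cball by blast
    have sub: "{t - e..t + e} \<subseteq> {0<..<1} - S"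
      using e by (simp add: cball_eq_atLeastAtMost)
    have "t - e \<in> {0<..<1} - S" "t + e \<in> {0<..<1} - S"
      using subsetD[OF sub, of "t - e"] subsetD[OF sub, of "t + e"] e(1) by simp_all
    moreover have "{t - e<..<t + e} \<inter> S = {}"
    proof -
      have "{t - e<..<t + e} \<subseteq> {t - e..t + e}" by (rule greaterThanLessThan_subseteq_atLeastAtMost_iff[THEN iffD2]) simp
      with sub show ?thesis by blast
    qed
    ultimately have "C1_curve_on \<A> (t - e) (t + e) \<gamma>"
      using e(1) by (intro S(2)) simp_all
    then show ?thesis using e(1) unfolding regular_at_def
      by (intro exI[of _ "t - e"] exI[of _ "t + e"]) auto
  qed
  with S(1) show ?thesis using that by blast
qed

section \<open>Reversing and joining curves\<close>

text \<open>The length of \<open>\<gamma>\<close> is the integral of the speed of the reparametrised curve \<open>\<delta>\<close> over the interval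
  on which \<open>\<delta>\<close> runs through \<open>\<gamma>\<close>. The integrand is supplied as a Borel function \<open>\<psi>\<close>, equal to the speed
  only almost everywhere, because \<open>curve_speed\<close> is uncontrolled at the break points while additivity
  of the integral requires measurable integrands.\<close>

lemma curve_speed_affine_measurable:
  assumes \<gamma>: "piecewise_C1_curve \<A> \<gamma>" and p: "p \<noteq> 0"
    and eq: "\<And>t. q + p * t \<in> {0..1} \<Longrightarrow> \<delta> t = \<gamma> (q + p * t)"
  obtains \<psi> :: "real \<Rightarrow> ennreal" where "\<psi> \<in> borel_measurable borel"
    "(\<integral>\<^sup>+t. \<psi> t \<partial>lborel) = curve_length \<A> g \<gamma>"
    "AE t in lborel. \<psi> t = ennreal (curve_speed \<A> g \<delta> t) * indicator {0..1} (q + p * t)"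
proof -
  obtain S where S: "finite S" "\<And>t. t \<in> {0<..<1} - S \<Longrightarrow> regular_at \<gamma> t"
    using piecewise_C1_regular[OF \<gamma>] by blast
  let ?R = "{0<..<1} - S"
  define \<phi> where "\<phi> t = ennreal (indicator ?R t *\<^sub>R curve_speed \<A> g \<gamma> t)" for t
  have "open ?R" using S(1) by (simp add: finite_imp_closed open_Diff)
  have "continuous_on ?R (curve_speed \<A> g \<gamma>)"
    using S(2) regular_atD(3) by (intro continuous_at_imp_continuous_on) auto
  then have [measurable]: "\<phi> \<in> borel_measurable borel"
    unfolding \<phi>_def using borel_measurable_continuous_on_indicator[of ?R "curve_speed \<A> g \<gamma>"] \<open>open ?R\<close>
    by (simp add: borel_open)
  have "finite (S \<union> {0, 1})" using S(1) by simp
  then have "AE t in lborel. t \<notin> S \<union> {0, 1}"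
    by (intro AE_not_in finite_imp_null_set_lborel)
  then have "AE t in lborel. ennreal (curve_speed \<A> g \<gamma> t) * indicator {0..1} t = \<phi> t"
    by eventually_elim (auto simp: \<phi>_def indicator_def)
  then have len: "curve_length \<A> g \<gamma> = (\<integral>\<^sup>+t. \<phi> t \<partial>lborel)"
    unfolding curve_length_def by (rule nn_integral_cong_AE)
  define \<psi> where "\<psi> t = ennreal \<bar>p\<bar> * \<phi> (q + p * t)" for t
  have [measurable]: "\<psi> \<in> borel_measurable borel" unfolding \<psi>_def by measurable
  have int: "(\<integral>\<^sup>+t. \<psi> t \<partial>lborel) = curve_length \<A> g \<gamma>"
    unfolding len \<psi>_def nn_integral_real_affine[OF \<open>\<phi> \<in> _\<close> p, of q]
    by (rule nn_integral_cmult) measurable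
  have "finite ((\<lambda>s. (s - q) / p) ` (S \<union> {0, 1}))" using S(1) by simp
  then have "AE t in lborel. t \<notin> (\<lambda>s. (s - q) / p) ` (S \<union> {0, 1})"
    by (intro AE_not_in finite_imp_null_set_lborel)
  then have "AE t in lborel. \<psi> t = ennreal (curve_speed \<A> g \<delta> t) * indicator {0..1} (q + p * t)"
  proof eventually_elim
    case (elim t)
    have "q + p * t \<notin> S \<union> {0, 1}"
    proof
      assume "q + p * t \<in> S \<union> {0, 1}"
      then have "((q + p * t) - q) / p \<in> (\<lambda>s. (s - q) / p) ` (S \<union> {0, 1})" by (rule imageI)
      then show False using elim p by simp
    qed
    then consider "q + p * t \<in> ?R" | "q + p * t \<notin> {0..1}" by force
    then show ?case
    proof cases
      case 1
      have "open ((\<lambda>s. q + p * s) -` {0<..<1})"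
        by (rule open_vimage[OF open_greaterThanLessThan]) (intro continuous_intros)
      then have "eventually (\<lambda>s. s \<in> (\<lambda>s. q + p * s) -` {0<..<1}) (nhds t)"
        by (rule eventually_nhds_in_open) (use 1 in auto)
      then have "eventually (\<lambda>s. \<delta> s = \<gamma> (q + p * s)) (nhds t)"
        by eventually_elim (use eq in auto)
      from curve_speed_affine[OF S(2)[OF 1] this] 1 show ?thesis
        by (simp add: \<psi>_def \<phi>_def ennreal_mult')
    next
      case 2
      then show ?thesis by (auto simp: \<psi>_def \<phi>_def indicator_def)
    qed
  qed
  with int show ?thesis using that \<open>\<psi> \<in> _\<close> by blast
qed

lemma C1_curve_on_affine:
  assumes \<gamma>: "C1_curve_on \<A> a' b' \<gamma>"
    and eq: "\<And>t. t \<in> {a..b} \<Longrightarrow> q + p * t \<in> {a'..b'} \<and> \<delta> t = \<gamma> (q + p * t)"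
  shows "C1_curve_on \<A> a b \<delta>"
  unfolding C1_curve_on_def
proof (intro conjI ballI)
  let ?\<sigma> = "\<lambda>t. q + p * t"
  have \<sigma>: "continuous_on T ?\<sigma>" for T by (intro continuous_intros)
  have "continuous_on {a..b} (\<lambda>t. \<gamma> (?\<sigma> t))"
    by (rule continuous_on_compose2[OF _ \<sigma>]) (use \<gamma> eq in \<open>auto simp: C1_curve_on_def\<close>)
  then show "continuous_on {a..b} \<delta>" by (rule continuous_on_eq) (use eq in auto)
  fix c assume "c \<in> \<A>"
  then obtain D where D: "continuous_on ({a'..b'} \<inter> \<gamma> -` chart_dom c) D"
      "\<And>t. t\<in>{a'..b'} \<inter> \<gamma> -` chart_dom c \<Longrightarrow>
           ((chart_map c \<circ> \<gamma>) has_vector_derivative D t) (at t within {a'..b'})"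
    using \<gamma> unfolding C1_curve_on_def by meson
  show "\<exists>D. continuous_on ({a..b} \<inter> \<delta> -` chart_dom c) D \<and>
        (\<forall>t\<in>{a..b} \<inter> \<delta> -` chart_dom c.
           ((chart_map c \<circ> \<delta>) has_vector_derivative D t) (at t within {a..b}))"
  proof (intro exI[of _ "\<lambda>t. p *\<^sub>R D (?\<sigma> t)"] conjI ballI)
    show "continuous_on ({a..b} \<inter> \<delta> -` chart_dom c) (\<lambda>t. p *\<^sub>R D (?\<sigma> t))"
      by (intro continuous_on_scaleR continuous_on_const continuous_on_compose2[OF D(1) \<sigma>])
         (use eq in auto)
    fix t assume t: "t \<in> {a..b} \<inter> \<delta> -` chart_dom c"
    then have "?\<sigma> t \<in> {a'..b'} \<inter> \<gamma> -` chart_dom c" using eq[of t] by auto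
    from D(2)[OF this] have "((chart_map c \<circ> \<gamma>) has_vector_derivative D (?\<sigma> t)) (at (?\<sigma> t) within ?\<sigma> ` {a..b})"
      by (rule has_vector_derivative_within_subset) (use eq in auto)
    moreover have "(?\<sigma> has_vector_derivative p) (at t within {a..b})"
      by (auto intro!: derivative_eq_intros simp: has_real_derivative_iff_has_vector_derivative[symmetric])
    ultimately have "((chart_map c \<circ> \<gamma> \<circ> ?\<sigma>) has_vector_derivative p *\<^sub>R D (?\<sigma> t)) (at t within {a..b})"
      by (intro vector_diff_chain_within)
    then show "((chart_map c \<circ> \<delta>) has_vector_derivative p *\<^sub>R D (?\<sigma> t)) (at t within {a..b})"
      by (rule has_vector_derivative_transform[rotated 2]) (use t eq in auto)
  qed
qed

lemma piecewise_C1_reversepath: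
  assumes "piecewise_C1_curve \<A> \<gamma>" shows "piecewise_C1_curve \<A> (reversepath \<gamma>)"
proof -
  obtain S where S: "finite S" "continuous_on {0..1} \<gamma>"
    "\<And>a b. 0 \<le> a \<Longrightarrow> a < b \<Longrightarrow> b \<le> 1 \<Longrightarrow> {a<..<b} \<inter> S = {} \<Longrightarrow> C1_curve_on \<A> a b \<gamma>"
    using assms unfolding piecewise_C1_curve_def by blast
  have "C1_curve_on \<A> a b (reversepath \<gamma>)"
    if "0 \<le> a" "a < b" "b \<le> 1" "{a<..<b} \<inter> (\<lambda>s. 1 - s) ` S = {}" for a b
  proof (rule C1_curve_on_affine[where q=1 and p="-1" and \<gamma>=\<gamma> and a'="1-b" and b'="1-a"])
    have "s \<notin> S" if "s \<in> {1-b<..<1-a}" for s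
    proof
      assume "s \<in> S"
      have "1 - s \<in> {a<..<b} \<inter> (\<lambda>s. 1 - s) ` S" using that \<open>s \<in> S\<close> by auto
      then show False using \<open>_ = {}\<close> by blast
    qed
    then have "{1-b<..<1-a} \<inter> S = {}" by (auto simp del: greaterThanLessThan_iff)
    then show "C1_curve_on \<A> (1-b) (1-a) \<gamma>" using that by (intro S(3)) auto
  qed (auto simp: reversepath_def)
  moreover have "continuous_on {0..1} (reversepath \<gamma>)"
    using S(2) path_reversepath[of \<gamma>] by (simp add: path_def)
  ultimately show ?thesis
    unfolding piecewise_C1_curve_def using S(1)
    by (intro conjI exI[of _ "(\<lambda>s. 1 - s) ` S"]) simp_all
qed

lemma curve_length_reversepath:
  assumes "piecewise_C1_curve \<A> \<gamma>"
  shows "curve_length \<A> g (reversepath \<gamma>) = curve_length \<A> g \<gamma>"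
proof -
  obtain \<psi> :: "real \<Rightarrow> ennreal" where \<psi>: "(\<integral>\<^sup>+t. \<psi> t \<partial>lborel) = curve_length \<A> g \<gamma>"
    "AE t in lborel. \<psi> t = ennreal (curve_speed \<A> g (reversepath \<gamma>) t) * indicator {0..1} (1 + (-1) * t)"
    using curve_speed_affine_measurable[OF assms, of "-1" 1 "reversepath \<gamma>"]
    by (auto simp: reversepath_def)
  have "curve_length \<A> g (reversepath \<gamma>) = (\<integral>\<^sup>+t. \<psi> t \<partial>lborel)"
    unfolding curve_length_def
    by (rule nn_integral_cong_AE) (use \<psi>(2) in \<open>eventually_elim; auto simp: indicator_def\<close>)
  then show ?thesis using \<psi>(1) by simp
qed

text \<open>Besides the rescaled break points of the two curves, the joining time \<open>1/2\<close> is a break point.\<close>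

lemma piecewise_C1_joinpaths:
  assumes "piecewise_C1_curve \<A> \<gamma>\<^sub>1" "piecewise_C1_curve \<A> \<gamma>\<^sub>2" and fit: "\<gamma>\<^sub>1 1 = \<gamma>\<^sub>2 0"
  shows "piecewise_C1_curve \<A> (\<gamma>\<^sub>1 +++ \<gamma>\<^sub>2)"
proof -
  obtain S where S: "finite S" "continuous_on {0..1} \<gamma>\<^sub>1"
    "\<And>a b. 0 \<le> a \<Longrightarrow> a < b \<Longrightarrow> b \<le> 1 \<Longrightarrow> {a<..<b} \<inter> S = {} \<Longrightarrow> C1_curve_on \<A> a b \<gamma>\<^sub>1"
    using assms(1) unfolding piecewise_C1_curve_def by blast
  obtain T where T: "finite T" "continuous_on {0..1} \<gamma>\<^sub>2"
    "\<And>a b. 0 \<le> a \<Longrightarrow> a < b \<Longrightarrow> b \<le> 1 \<Longrightarrow> {a<..<b} \<inter> T = {} \<Longrightarrow> C1_curve_on \<A> a b \<gamma>\<^sub>2"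
    using assms(2) unfolding piecewise_C1_curve_def by blast
  let ?U = "{1/2} \<union> (\<lambda>s. s / 2) ` S \<union> (\<lambda>s. (s + 1) / 2) ` T"
  have "C1_curve_on \<A> a b (\<gamma>\<^sub>1 +++ \<gamma>\<^sub>2)"
    if ab: "0 \<le> a" "a < b" "b \<le> 1" and U: "{a<..<b} \<inter> ?U = {}" for a b
  proof -
    have "1/2 \<notin> {a<..<b}" using U by blast
    then consider "b \<le> 1/2" | "1/2 \<le> a" by force
    then show ?thesis
    proof cases
      case 1
      show ?thesis
      proof (rule C1_curve_on_affine[where q=0 and p=2 and \<gamma>=\<gamma>\<^sub>1 and a'="2*a" and b'="2*b"])
        have "s \<notin> S" if "s \<in> {2*a<..<2*b}" for s
        proof
          assume "s \<in> S"
          have "s / 2 \<in> {a<..<b} \<inter> ?U" using that \<open>s \<in> S\<close> by auto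
          then show False using U by blast
        qed
        then have "{2*a<..<2*b} \<inter> S = {}" by (auto simp del: greaterThanLessThan_iff)
        then show "C1_curve_on \<A> (2*a) (2*b) \<gamma>\<^sub>1" using ab 1 by (intro S(3)) auto
      qed (use 1 in \<open>auto simp: joinpaths_def\<close>)
    next
      case 2
      show ?thesis
      proof (rule C1_curve_on_affine[where q="-1" and p=2 and \<gamma>=\<gamma>\<^sub>2 and a'="2*a-1" and b'="2*b-1"])
        have "s \<notin> T" if "s \<in> {2*a-1<..<2*b-1}" for s
        proof
          assume "s \<in> T"
          have "(s + 1) / 2 \<in> {a<..<b} \<inter> ?U" using that \<open>s \<in> T\<close> by auto
          then show False using U by blast
        qed
        then have "{2*a-1<..<2*b-1} \<inter> T = {}" by (auto simp del: greaterThanLessThan_iff)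
        then show "C1_curve_on \<A> (2*a-1) (2*b-1) \<gamma>\<^sub>2" using ab 2 by (intro T(3)) auto
        show "- 1 + 2 * t \<in> {2*a-1..2*b-1} \<and> (\<gamma>\<^sub>1 +++ \<gamma>\<^sub>2) t = \<gamma>\<^sub>2 (- 1 + 2 * t)"
          if "t \<in> {a..b}" for t
        proof (cases "t = 1/2")
          case True show ?thesis unfolding True using that True by (simp add: joinpaths_def fit)
        next
          case False then show ?thesis using that 2 by (auto simp: joinpaths_def)
        qed
      qed
    qed
  qed
  moreover have "continuous_on {0..1} (\<gamma>\<^sub>1 +++ \<gamma>\<^sub>2)"
    using path_join_imp[of \<gamma>\<^sub>1 \<gamma>\<^sub>2] S(2) T(2) fit by (simp add: path_def pathfinish_def pathstart_def)
  moreover have "finite ?U" using S(1) T(1) by simp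
  ultimately show ?thesis
    unfolding piecewise_C1_curve_def by (intro conjI exI[of _ ?U]) simp_all
qed

lemma curve_length_joinpaths:
  assumes "piecewise_C1_curve \<A> \<gamma>\<^sub>1" "piecewise_C1_curve \<A> \<gamma>\<^sub>2" and fit: "\<gamma>\<^sub>1 1 = \<gamma>\<^sub>2 0"
  shows "curve_length \<A> g (\<gamma>\<^sub>1 +++ \<gamma>\<^sub>2) = curve_length \<A> g \<gamma>\<^sub>1 + curve_length \<A> g \<gamma>\<^sub>2"
proof -
  let ?\<gamma> = "\<gamma>\<^sub>1 +++ \<gamma>\<^sub>2"
  have eq1: "?\<gamma> t = \<gamma>\<^sub>1 (0 + 2 * t)" if "0 + 2 * t \<in> {0..1}" for t
    using that by (auto simp: joinpaths_def)
  have eq2: "?\<gamma> t = \<gamma>\<^sub>2 (- 1 + 2 * t)" if "- 1 + 2 * t \<in> {0..1}" for t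
  proof (cases "t = 1/2")
    case True show ?thesis unfolding True by (simp add: joinpaths_def fit)
  next
    case False then show ?thesis using that by (auto simp: joinpaths_def)
  qed
  obtain \<psi>\<^sub>1 :: "real \<Rightarrow> ennreal" where \<psi>\<^sub>1: "\<psi>\<^sub>1 \<in> borel_measurable borel"
    "(\<integral>\<^sup>+t. \<psi>\<^sub>1 t \<partial>lborel) = curve_length \<A> g \<gamma>\<^sub>1"
    "AE t in lborel. \<psi>\<^sub>1 t = ennreal (curve_speed \<A> g ?\<gamma> t) * indicator {0..1} (0 + 2 * t)"
    using curve_speed_affine_measurable[OF assms(1) _ eq1] by auto
  obtain \<psi>\<^sub>2 :: "real \<Rightarrow> ennreal" where \<psi>\<^sub>2: "\<psi>\<^sub>2 \<in> borel_measurable borel"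
    "(\<integral>\<^sup>+t. \<psi>\<^sub>2 t \<partial>lborel) = curve_length \<A> g \<gamma>\<^sub>2"
    "AE t in lborel. \<psi>\<^sub>2 t = ennreal (curve_speed \<A> g ?\<gamma> t) * indicator {0..1} (- 1 + 2 * t)"
    using curve_speed_affine_measurable[OF assms(2) _ eq2] by auto
  have "AE t in lborel. t \<noteq> 1/2" by (rule AE_lborel_singleton)
  with \<psi>\<^sub>1(3) \<psi>\<^sub>2(3)
  have "AE t in lborel. ennreal (curve_speed \<A> g ?\<gamma> t) * indicator {0..1} t = \<psi>\<^sub>1 t + \<psi>\<^sub>2 t"
    by eventually_elim (auto simp: indicator_def)
  then have "curve_length \<A> g ?\<gamma> = (\<integral>\<^sup>+t. \<psi>\<^sub>1 t + \<psi>\<^sub>2 t \<partial>lborel)"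
    unfolding curve_length_def by (rule nn_integral_cong_AE)
  also have "\<dots> = (\<integral>\<^sup>+t. \<psi>\<^sub>1 t \<partial>lborel) + (\<integral>\<^sup>+t. \<psi>\<^sub>2 t \<partial>lborel)"
    using \<psi>\<^sub>1(1) \<psi>\<^sub>2(1) by (intro nn_integral_add) auto
  finally show ?thesis using \<psi>\<^sub>1(2) \<psi>\<^sub>2(2) by simp
qed

section \<open>The distance and its neighbourhoods\<close>

text \<open>The metric axioms are stated with strict inequalities \<open>d(x, y) < r\<close>: such an inequality is
  witnessed by a single curve, and this is the form in which neighbourhoods use the distance.\<close>

lemma riemannian_dist_less_iff:
  "riemannian_dist \<A> g x y < r \<longleftrightarrow>
     (\<exists>\<gamma>. piecewise_C1_curve \<A> \<gamma> \<and> \<gamma> 0 = x \<and> \<gamma> 1 = y \<and> curve_length \<A> g \<gamma> < r)"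
  unfolding riemannian_dist_def INF_less_iff by auto

lemma riemannian_dist_sym_less:
  assumes "riemannian_dist \<A> g x y < r" shows "riemannian_dist \<A> g y x < r"
proof -
  obtain \<gamma> where "piecewise_C1_curve \<A> \<gamma>" "\<gamma> 0 = x" "\<gamma> 1 = y" "curve_length \<A> g \<gamma> < r"
    using assms riemannian_dist_less_iff by blast
  then show ?thesis
    unfolding riemannian_dist_less_iff
    by (intro exI[of _ "reversepath \<gamma>"])
       (auto simp: curve_length_reversepath piecewise_C1_reversepath, auto simp: reversepath_def)
qed

lemma riemannian_dist_triangle_less:
  assumes "riemannian_dist \<A> g x y < r" "riemannian_dist \<A> g y z < s"
  shows "riemannian_dist \<A> g x z < r + s"
proof -
  obtain \<gamma>\<^sub>1 where 1: "piecewise_C1_curve \<A> \<gamma>\<^sub>1" "\<gamma>\<^sub>1 0 = x" "\<gamma>\<^sub>1 1 = y" "curve_length \<A> g \<gamma>\<^sub>1 < r"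
    using assms(1) riemannian_dist_less_iff by blast
  obtain \<gamma>\<^sub>2 where 2: "piecewise_C1_curve \<A> \<gamma>\<^sub>2" "\<gamma>\<^sub>2 0 = y" "\<gamma>\<^sub>2 1 = z" "curve_length \<A> g \<gamma>\<^sub>2 < s"
    using assms(2) riemannian_dist_less_iff by blast
  show ?thesis
    unfolding riemannian_dist_less_iff
  proof (intro exI[of _ "\<gamma>\<^sub>1 +++ \<gamma>\<^sub>2"] conjI)
    have "curve_length \<A> g \<gamma>\<^sub>1 + curve_length \<A> g \<gamma>\<^sub>2 < curve_length \<A> g \<gamma>\<^sub>1 + s"
      using 1(4) 2(4) by (auto simp: ennreal_add_left_cancel_less)
    also have "\<dots> \<le> r + s" using 1(4) by (intro add_right_mono) simp
    finally show "curve_length \<A> g (\<gamma>\<^sub>1 +++ \<gamma>\<^sub>2) < r + s"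
      using 1 2 by (simp add: curve_length_joinpaths)
      show "piecewise_C1_curve \<A> (\<gamma>\<^sub>1 +++ \<gamma>\<^sub>2)" using 1 2 by (simp add: piecewise_C1_joinpaths)
  qed (use 1 2 in \<open>auto simp: joinpaths_def\<close>)
qed

lemma segment_in_chart_C1:
  assumes c: "c \<in> \<A>" and seg: "\<And>t. t \<in> {0..1} \<Longrightarrow> z + t *\<^sub>R w \<in> chart_image c"
    and ab: "0 \<le> a" "b \<le> 1"
  shows "C1_curve_on \<A> a b (\<lambda>t. chart_inv c (z + t *\<^sub>R w))"
  unfolding C1_curve_on_def
proof (intro conjI ballI)
  let ?l = "\<lambda>t. z + t *\<^sub>R w" and ?\<gamma> = "\<lambda>t. chart_inv c (z + t *\<^sub>R w)"
  have l: "continuous_on T ?l" for T by (intro continuous_intros)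
  have inv: "continuous_on (chart_image c) (chart_inv c)"
    using chart_homeomorphism[OF c] by (auto simp: homeomorphism_def)
  show cont: "continuous_on {a..b} ?\<gamma>"
    by (rule continuous_on_compose2[OF inv l]) (use seg ab in auto)
  fix c' assume c': "c' \<in> \<A>"
  let ?T = "\<lambda>x. frechet_derivative (transition c c') (at x) w"
  show "\<exists>D. continuous_on ({a..b} \<inter> ?\<gamma> -` chart_dom c') D \<and>
        (\<forall>t\<in>{a..b} \<inter> ?\<gamma> -` chart_dom c'.
           ((chart_map c' \<circ> ?\<gamma>) has_vector_derivative D t) (at t within {a..b}))"
  proof (intro exI[of _ "\<lambda>t. ?T (?l t)"] conjI ballI)
    have "?l t \<in> chart_map c ` (chart_dom c \<inter> chart_dom c')"
      if "t \<in> {a..b} \<inter> ?\<gamma> -` chart_dom c'" for t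
      using that seg[of t] ab c chart_inv_in_dom[OF c seg[of t]]
      by (intro image_eqI[where x="?\<gamma> t"]) auto
    then show "continuous_on ({a..b} \<inter> ?\<gamma> -` chart_dom c') (\<lambda>t. ?T (?l t))"
      by (intro continuous_on_compose2[OF transition_derivative_continuous[OF c c'] l]) auto
    fix t assume t: "t \<in> {a..b} \<inter> ?\<gamma> -` chart_dom c'"
    have dom: "?\<gamma> t \<in> chart_dom c" using chart_inv_in_dom[OF c seg[of t]] t ab by auto
    have "(?l has_vector_derivative w) (at t within {a..b})"
      by (auto intro!: derivative_eq_intros)
    then have "((chart_map c \<circ> ?\<gamma>) has_vector_derivative w) (at t within {a..b})"
      by (rule has_vector_derivative_transform[rotated 2]) (use t c seg ab in auto)
    from transition_compose_derivative[OF c c' dom _ this] t cont c seg[of t] ab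
    show "((chart_map c' \<circ> ?\<gamma>) has_vector_derivative ?T (?l t)) (at t within {a..b})"
      by (auto simp: continuous_on_eq_continuous_within)
  qed
qed

text \<open>The coordinate velocity of a straight segment is the constant vector \<open>w\<close>.\<close>

lemma segment_in_chart_speed:
  assumes c: "c \<in> \<A>" and seg: "\<And>t. t \<in> {0..1} \<Longrightarrow> z + t *\<^sub>R w \<in> chart_image c"
    and t: "t \<in> {0<..<1}"
  shows "curve_speed \<A> g (\<lambda>t. chart_inv c (z + t *\<^sub>R w)) t =
           sqrt (g c (chart_inv c (z + t *\<^sub>R w)) w w)"
proof -
  let ?\<gamma> = "\<lambda>t. chart_inv c (z + t *\<^sub>R w)"
  have "regular_at ?\<gamma> t"
    using segment_in_chart_C1[OF c seg, of 0 1] t unfolding regular_at_def by force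
  then have cont: "isCont ?\<gamma> t" by (rule regular_atD)
  have "((\<lambda>t. z + t *\<^sub>R w) has_vector_derivative w) (at t)"
    by (auto intro!: derivative_eq_intros)
  then have d: "((chart_map c \<circ> ?\<gamma>) has_vector_derivative w) (at t)"
    by (rule has_vector_derivative_transform_within_open[of _ _ _ "{0<..<1}"])
       (use t c seg in auto)
  show ?thesis
    by (rule curve_speed_in_chart[OF c _ d cont]) (use chart_inv_in_dom[OF c seg[of t]] t in auto)
qed

text \<open>In a chart \<open>c\<close> around \<open>x\<close> join \<open>x\<close> to a nearby point by a straight coordinate segment with velocity
  \<open>w\<close>. The squared speed \<open>g(w, w)\<close> is jointly continuous in base point and velocity and vanishes for
  \<open>w = 0\<close>, so it stays below \<open>(e / 2)\<^sup>2\<close> for short segments; joint continuity replaces a comparison of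
  the metric with the Euclidean one.\<close>

lemma riemannian_dist_locally_small:
  assumes e: "e > 0"
  obtains V where "open V" "x \<in> V" "\<And>y. y \<in> V \<Longrightarrow> riemannian_dist \<A> g x y < ennreal e"
proof -
  obtain c where c: "c \<in> \<A>" "x \<in> chart_dom c" using chart_at .
  let ?z = "chart_map c x" and ?G = "\<lambda>(x, v). g c (chart_inv c x) v v"
  have z: "?z \<in> chart_image c" using c by simp
  have op: "open (chart_image c \<times> (UNIV :: (real^'n) set))"
    using chart_image_open[OF c(1)] by (intro open_Times) auto
  have "isCont ?G (?z, 0)"
    using metric_continuous[OF c(1)] op z by (auto simp: continuous_on_eq_continuous_at)
  moreover have "?G (?z, 0) = 0"
    using bilinear_lzero[OF metric_bilinear[OF c]] c by simp
  ultimately have "(?G \<longlongrightarrow> 0) (nhds (?z, 0))"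
    using tendsto_at_iff_tendsto_nhds[of ?G "(?z, 0)"] unfolding isCont_def by (simp only:)
  then have "eventually (\<lambda>q. ?G q < (e / 2)\<^sup>2) (nhds (?z, 0))"
    by (rule order_tendstoD) (use e in simp)
  moreover have "eventually (\<lambda>q. q \<in> chart_image c \<times> (UNIV :: (real^'n) set)) (nhds (?z, 0))"
    by (rule eventually_nhds_in_open[OF op]) (use z in simp)
  ultimately have "eventually (\<lambda>q. ?G q < (e / 2)\<^sup>2 \<and> fst q \<in> chart_image c) (nhds (?z, 0))"
    by eventually_elim auto
  then obtain P Q where PQ: "eventually P (nhds ?z)" "eventually Q (nhds 0)"
    "\<And>x v. P x \<Longrightarrow> Q v \<Longrightarrow> ?G (x, v) < (e / 2)\<^sup>2 \<and> x \<in> chart_image c"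
    unfolding nhds_prod eventually_prod_filter by auto
  obtain d1 where d1: "d1 > 0" "\<And>x. dist x ?z < d1 \<Longrightarrow> P x"
    using PQ(1) unfolding eventually_nhds_metric by blast
  obtain d2 where d2: "d2 > 0" "\<And>v. dist v 0 < d2 \<Longrightarrow> Q v"
    using PQ(2) unfolding eventually_nhds_metric by blast
  define d where "d = min d1 d2"
  have d: "d > 0" "\<And>x v :: real^'n. dist x ?z < d \<Longrightarrow> norm v < d \<Longrightarrow>
      g c (chart_inv c x) v v < (e / 2)\<^sup>2 \<and> x \<in> chart_image c"
  proof -
    show "d > 0" using d1(1) d2(1) by (simp add: d_def)
    fix x v :: "real^'n" assume "dist x ?z < d" "norm v < d"
    then have "P x" "Q v" using d1(2)[of x] d2(2)[of v] by (simp_all add: d_def)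
    from PQ(3)[OF this] show "g c (chart_inv c x) v v < (e / 2)\<^sup>2 \<and> x \<in> chart_image c"
      by simp
  qed
  have cm: "continuous_on (chart_dom c) (chart_map c)"
    using chart_homeomorphism[OF c(1)] by (auto simp: homeomorphism_def)
  show ?thesis
  proof
    show "open (chart_dom c \<inter> chart_map c -` ball ?z d)"
      using continuous_on_open_vimage[OF chart_dom_open[OF c(1)]] cm by (metis Int_commute open_ball)
    show "x \<in> chart_dom c \<inter> chart_map c -` ball ?z d" using c d by simp
    fix y assume y: "y \<in> chart_dom c \<inter> chart_map c -` ball ?z d"
    define w where "w = chart_map c y - ?z"
    have w: "norm w < d" using y by (simp add: w_def dist_norm norm_minus_commute)
    have close: "dist (?z + t *\<^sub>R w) ?z < d" if "t \<in> {0..1}" for t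
    proof -
      have "\<bar>t\<bar> * norm w \<le> 1 * norm w" using that by (intro mult_right_mono) auto
      then show ?thesis using w by (simp add: dist_norm)
    qed
    have seg: "?z + t *\<^sub>R w \<in> chart_image c" if "t \<in> {0..1}" for t
      using d(2)[OF close[OF that] w] by simp
    let ?\<gamma> = "\<lambda>t. chart_inv c (?z + t *\<^sub>R w)"
    have "piecewise_C1_curve \<A> ?\<gamma>"
      unfolding piecewise_C1_curve_def
    proof (intro conjI exI[of _ "{}"] allI impI)
      show "continuous_on {0..1} ?\<gamma>"
        using segment_in_chart_C1[OF c(1) seg, of 0 1] by (simp add: C1_curve_on_def)
      fix a b :: real assume "0 \<le> a \<and> a < b \<and> b \<le> 1 \<and> {a<..<b} \<inter> {} = {}"
      then show "C1_curve_on \<A> a b ?\<gamma>" by (intro segment_in_chart_C1[OF c(1) seg]) simp_all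
    qed simp
    moreover have "curve_length \<A> g ?\<gamma> \<le> (\<integral>\<^sup>+t. ennreal (e / 2) * indicator {0..1::real} t \<partial>lborel)"
      unfolding curve_length_def
    proof (rule nn_integral_mono_AE)
      have "AE t in lborel. t \<noteq> (0::real)" "AE t in lborel. t \<noteq> (1::real)"
        by (rule AE_lborel_singleton)+
      then show "AE t in lborel. ennreal (curve_speed \<A> g ?\<gamma> t) * indicator {0..1} t
                  \<le> ennreal (e / 2) * indicator {0..1} t"
      proof eventually_elim
        case (elim t)
        have "curve_speed \<A> g ?\<gamma> t \<le> e / 2" if "t \<in> {0..1}"
        proof -
          have "g c (?\<gamma> t) w w \<le> (e / 2)\<^sup>2" using d(2)[OF close[OF that] w] by simp
          then have "sqrt (g c (?\<gamma> t) w w) \<le> e / 2" using e by (intro real_le_lsqrt) auto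
          moreover have "t \<in> {0<..<1}" using that elim by simp
          ultimately show ?thesis by (subst segment_in_chart_speed[OF c(1) seg])
        qed
        then show ?case by (cases "t \<in> {0..1}") (simp_all add: ennreal_leI)
      qed
    qed
    moreover have "(\<integral>\<^sup>+t. ennreal (e / 2) * indicator {0..1::real} t \<partial>lborel) = ennreal (e / 2)"
      by (subst nn_integral_cmult_indicator) auto
    moreover have "ennreal (e / 2) < ennreal e" using e by (simp add: ennreal_less_iff)
    moreover have "?\<gamma> 0 = x" "?\<gamma> 1 = y" using c y by (auto simp: w_def)
    ultimately show "riemannian_dist \<A> g x y < ennreal e"
      unfolding riemannian_dist_less_iff by (intro exI[of _ ?\<gamma>] conjI) simp_all
  qed
qed

lemma riemannian_dist_refl_less: "e > 0 \<Longrightarrow> riemannian_dist \<A> g x x < ennreal e"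
  using riemannian_dist_locally_small[of e x] by blast

lemma subset_nbhd: "r > 0 \<Longrightarrow> A \<subseteq> nbhd \<A> g r A"
  using riemannian_dist_refl_less by (auto simp: nbhd_def)

text \<open>The triangle inequality in the form that bounds the boundary measure of a neighbourhood by the
  growth rate of its measure in the radius.\<close>

lemma nbhd_nbhd_subset:
  assumes "r \<ge> 0" "s \<ge> 0" shows "nbhd \<A> g s (nbhd \<A> g r A) \<subseteq> nbhd \<A> g (r + s) A"
  using riemannian_dist_triangle_less[where r="ennreal r" and s="ennreal s"] assms
  by (auto simp: nbhd_def)

text \<open>Neighbourhoods have to be Borel sets in order to be competitors for the isoperimetric
  constant.\<close>

lemma open_nbhd: "open (nbhd \<A> g r A)"
proof (subst open_subopen, intro ballI)
  fix x assume "x \<in> nbhd \<A> g r A"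
  then obtain a where a: "a \<in> A" "riemannian_dist \<A> g a x < ennreal r" by (auto simp: nbhd_def)
  obtain r' where r': "riemannian_dist \<A> g a x < r'" "r' < ennreal r" using dense[OF a(2)] by blast
  define s where "s = enn2real r'"
  have s: "r' = ennreal s" "0 \<le> s" "s < r"
  proof -
    have "r' < top" using r'(2) by (metis ennreal_less_top less_trans)
    then show "r' = ennreal s" by (simp add: s_def)
    show "0 \<le> s" by (simp add: s_def)
    then show "s < r" using r'(2) unfolding \<open>r' = ennreal s\<close> by (simp only: ennreal_less_iff)
  qed
  have "r - s > 0" using s(3) by simp
  from riemannian_dist_locally_small[OF this, of x]
  obtain V where V: "open V" "x \<in> V" "\<And>y. y \<in> V \<Longrightarrow> riemannian_dist \<A> g x y < ennreal (r - s)"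
    by blast
  have "V \<subseteq> nbhd \<A> g r A"
  proof
    fix y assume "y \<in> V"
    then have "riemannian_dist \<A> g a y < ennreal s + ennreal (r - s)"
      by (intro riemannian_dist_triangle_less[OF r'(1)[unfolded s(1)]] V(3))
    also have "\<dots> = ennreal r" using s(2,3) by (subst ennreal_plus[symmetric]) simp_all
    finally show "y \<in> nbhd \<A> g r A" using a(1) by (auto simp: nbhd_def)
  qed
  with V(1,2) show "\<exists>T. open T \<and> x \<in> T \<and> T \<subseteq> nbhd \<A> g r A"
    by (intro exI[of _ V] conjI)
qed

lemma nbhd_disjoint:
  assumes rs: "0 \<le> r" "0 \<le> s" and sep: "ennreal (r + s) \<le> set_distance \<A> g A B"
  shows "nbhd \<A> g r A \<inter> nbhd \<A> g s B = {}"
proof (rule ccontr)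
  assume "nbhd \<A> g r A \<inter> nbhd \<A> g s B \<noteq> {}"
  then obtain x where "x \<in> nbhd \<A> g r A" "x \<in> nbhd \<A> g s B" by blast
  then obtain a b where ab: "a \<in> A" "riemannian_dist \<A> g a x < ennreal r"
      "b \<in> B" "riemannian_dist \<A> g b x < ennreal s"
    unfolding nbhd_def by blast
  have "set_distance \<A> g A B \<le> riemannian_dist \<A> g a b"
    unfolding set_distance_def by (rule INF_lower2[OF ab(1) INF_lower[OF ab(3)]])
  also have "\<dots> < ennreal (r + s)"
    using riemannian_dist_triangle_less[OF ab(2) riemannian_dist_sym_less[OF ab(4)]]
    unfolding ennreal_plus[OF rs] .
  finally have "set_distance \<A> g A B < ennreal (r + s)" .
  with leD[OF sep] show False by (rule notE)
qed

end

section \<open>Growth of the measure of neighbourhoods\<close>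

lemma (in prob_space) prob_le_one_minus_disjoint_union:
  assumes "finite I" "\<And>i. i \<in> I \<Longrightarrow> A i \<in> events" "B \<in> events"
    and "disjoint_family_on A I" "\<And>i. i \<in> I \<Longrightarrow> A i \<inter> B = {}"
  shows "prob B \<le> 1 - (\<Sum>i\<in>I. prob (A i))"
proof -
  have "A ` I \<subseteq> events" using assms(2) by blast
  then have "(\<Sum>i\<in>I. prob (A i)) + prob B = prob (\<Union>i\<in>I. A i) + prob B"
    using finite_measure_finite_Union[OF assms(1) _ assms(4)] by simp
  also have "\<dots> = prob ((\<Union>i\<in>I. A i) \<union> B)"
    using assms by (intro finite_measure_Union[symmetric]) auto
  also have "\<dots> \<le> 1" by simp
  finally show ?thesis by simp
qed

text \<open>A differential inequality for lower right derivatives, where \<open>F\<close> may jump: monotonicity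
  leaves only upward jumps, and these help. The set of times up to which the bound
  holds contains its supremum by monotonicity, and from there the growth hypothesis with the larger
  rate \<open>c'\<close> carries the bound a little further, because \<open>exp (c h) \<le> 1 + c' h\<close> for small \<open>h\<close>.\<close>

lemma exponential_growth:
  fixes F :: "real \<Rightarrow> real"
  assumes ab: "a \<le> b" and mono: "mono_on {a..b} F" and pos: "F a > 0" and c: "0 < c" "c < c'"
    and growth: "\<And>t. a \<le> t \<Longrightarrow> t < b \<Longrightarrow> \<forall>\<^sub>F h in at_right 0. F t * (1 + c' * h) \<le> F (t + h)"
  shows "F a * exp (c * (b - a)) \<le> F b"
proof -
  define S where "S = {t \<in> {a..b}. F a * exp (c * (t - a)) \<le> F t}"
  define u where "u = Sup S"
  have aS: "a \<in> S" using ab by (simp add: S_def)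
  have bdd: "bdd_above S" unfolding S_def by (rule bdd_aboveI[of _ b]) auto
  have "a \<le> u" unfolding u_def by (rule cSup_upper[OF aS bdd])
  moreover have "u \<le> b" unfolding u_def by (rule cSup_least) (use aS in \<open>auto simp: S_def\<close>)
  ultimately have u: "a \<le> u" "u \<le> b" .
  have "F a \<le> F u" using u ab by (intro mono_onD[OF mono]) auto
  then have "F u > 0" using pos by simp
  have "t \<le> a + ln (F u / F a) / c" if "t \<in> S" for t
  proof -
    have "t \<le> u" unfolding u_def by (rule cSup_upper[OF that bdd])
    then have "F t \<le> F u" using that u by (intro mono_onD[OF mono]) (auto simp: S_def)
    then have "F a * exp (c * (t - a)) \<le> F u" using that by (simp add: S_def)
    then have "exp (c * (t - a)) \<le> F u / F a" using pos by (simp add: le_divide_eq mult.commute)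
    then have "c * (t - a) \<le> ln (F u / F a)" using \<open>F u > 0\<close> pos by (subst ln_ge_iff) auto
    then have "t - a \<le> ln (F u / F a) / c"
      using c by (simp add: pos_le_divide_eq mult.commute del: ln_div)
    then show ?thesis by linarith
  qed
  then have "u \<le> a + ln (F u / F a) / c"
    using aS cSup_least[of S "a + ln (F u / F a) / c"] unfolding u_def by blast
  then have "u - a \<le> ln (F u / F a) / c" by linarith
  then have "c * (u - a) \<le> ln (F u / F a)"
    using c by (simp add: pos_le_divide_eq mult.commute del: ln_div)
  then have "exp (c * (u - a)) \<le> F u / F a" using \<open>F u > 0\<close> pos by (subst (asm) ln_ge_iff) auto
  then have uS: "F a * exp (c * (u - a)) \<le> F u" using pos by (simp add: le_divide_eq mult.commute)
  have "u = b"
  proof (rule ccontr)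
    assume "u \<noteq> b"
    then have "u < b" using u by simp
    have "((\<lambda>h. 1 + c' * h - exp (c * h)) has_real_derivative c' - c) (at 0)"
      by (auto intro!: derivative_eq_intros)
    moreover have "0 < c' - c" using c(2) by simp
    ultimately have "\<exists>d>0. \<forall>h>0. h < d \<longrightarrow>
        1 + c' * 0 - exp (c * 0) < 1 + c' * (0 + h) - exp (c * (0 + h))"
      by (rule DERIV_pos_inc_right)
    then obtain d where d: "d > 0" "\<forall>h>0. h < d \<longrightarrow> 0 < 1 + c' * h - exp (c * h)"
      by (simp only: add_0_left mult_zero_right exp_zero add_0_right diff_self) blast
    have "\<forall>\<^sub>F h in at_right 0. exp (c * h) \<le> 1 + c' * h"
      unfolding eventually_at_right_field
    proof (intro exI[of _ d] conjI allI impI)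
      fix h :: real assume "0 < h" "h < d"
      with d(2) have "0 < 1 + c' * h - exp (c * h)" by blast
      then show "exp (c * h) \<le> 1 + c' * h" by simp
    qed (rule d(1))
    moreover have "\<forall>\<^sub>F h in at_right 0. h < b - u \<and> 0 < h"
      unfolding eventually_at_right_field
      by (intro exI[of _ "b - u"]) (use \<open>u < b\<close> in simp)
    ultimately have "\<forall>\<^sub>F h in at_right 0. 0 < h \<and> u + h \<in> S"
      using growth[OF u(1) \<open>u < b\<close>]
    proof eventually_elim
      case (elim h)
      have "F a * exp (c * (u + h - a)) = F a * exp (c * (u - a)) * exp (c * h)"
      proof -
        have "c * (u + h - a) = c * (u - a) + c * h" by (simp add: algebra_simps)
        then show ?thesis by (simp add: exp_add)
      qed
      also have "\<dots> \<le> F u * (1 + c' * h)"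
        using uS elim \<open>F u > 0\<close> by (intro mult_mono) auto
      also have "\<dots> \<le> F (u + h)" using elim by simp
      finally show ?case using elim u by (auto simp: S_def)
    qed
    from eventually_happens'[OF _ this] obtain h where h: "0 < h" "u + h \<in> S"
      by (auto simp: trivial_limit_at_right_real)
    have "u + h \<le> u" unfolding u_def by (rule cSup_upper[OF h(2)[unfolded u_def] bdd])
    then show False using h(1) by simp
  qed
  then show ?thesis using uS by simp
qed

context riemannian_atlas
begin

text \<open>The neighbourhood of radius \<open>h\<close> of \<open>U\<^sub>t(A)\<close> lies in \<open>U\<^sub>t\<^sub>+\<^sub>h(A)\<close>. So a lower bound on the boundary
  measure of \<open>U\<^sub>t(A)\<close> is a lower bound on the lower right derivative of the measure of \<open>U\<^sub>t(A)\<close> in \<open>t\<close>.\<close>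

lemma measure_nbhd_growth:
  assumes m: "finite_measure m" "sets m = sets borel"
    and pos: "measure m A > 0" and ab: "0 < a" "a \<le> b" and c: "0 < c" "c < c'"
    and large: "\<And>t. a \<le> t \<Longrightarrow> t < b \<Longrightarrow>
      ereal c' < boundary_measure \<A> g m (nbhd \<A> g t A) / ereal (measure m (nbhd \<A> g t A))"
  shows "measure m A * exp (c * (b - a)) \<le> measure m (nbhd \<A> g b A)"
proof -
  interpret finite_measure m by fact
  define F where "F t = measure m (nbhd \<A> g t A)" for t
  have meas: "nbhd \<A> g t B \<in> sets m" for t B using m(2) open_nbhd by (simp add: borel_open)
  have mono: "F s \<le> F t" if "s \<le> t" for s t
    unfolding F_def
    by (rule finite_measure_mono[OF _ meas])
       (use that in \<open>auto simp: nbhd_def intro: less_le_trans ennreal_leI\<close>)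
  have FA: "measure m A \<le> F t" if "t > 0" for t
    unfolding F_def by (rule finite_measure_mono[OF subset_nbhd[OF that] meas])
  have "F a * exp (c * (b - a)) \<le> F b"
  proof (rule exponential_growth[OF ab(2) _ _ c])
    show "mono_on {a..b} F" using mono by (auto simp: mono_on_def)
    show "F a > 0" using FA[OF ab(1)] pos by simp
    fix t assume t: "a \<le> t" "t < b"
    have Ft: "F t > 0" using FA[of t] pos ab t by simp
    have "ereal (F t * c') < boundary_measure \<A> g m (nbhd \<A> g t A)"
      using large[OF t] Ft unfolding F_def[symmetric] by (subst (asm) ereal_less_divide_pos) auto
    then have "\<forall>\<^sub>F h in at_right 0. ereal (F t * c') <
        ereal ((measure m (nbhd \<A> g h (nbhd \<A> g t A)) - F t) / h)"
      unfolding boundary_measure_def F_def[symmetric] by (rule less_LiminfD)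
    moreover have "\<forall>\<^sub>F h in at_right (0::real). 0 < h" by (rule eventually_at_right_less)
    ultimately show "\<forall>\<^sub>F h in at_right 0. F t * (1 + c' * h) \<le> F (t + h)"
    proof eventually_elim
      case (elim h)
      have "measure m (nbhd \<A> g h (nbhd \<A> g t A)) \<le> F (t + h)"
        unfolding F_def by (rule finite_measure_mono[OF nbhd_nbhd_subset meas]) (use t ab elim in auto)
      moreover have "F t * c' * h < measure m (nbhd \<A> g h (nbhd \<A> g t A)) - F t"
        using elim by (simp add: field_simps)
      ultimately show ?case by (simp add: algebra_simps)
    qed
  qed
  moreover have "measure m A * exp (c * (b - a)) \<le> F a * exp (c * (b - a))"
    using FA[OF ab(1)] by simp
  ultimately show ?thesis unfolding F_def by (rule order_trans[rotated])
qed

section \<open>The isoperimetric bound\<close>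

text \<open>If the constant exceeded the bound, then for every choice of radii \<open>r\<^sub>\<alpha> < D / 2\<close>, made independently
  for the indices, some \<open>U(A\<^sub>\<alpha>)\<close> would have a large isoperimetric quotient. Choosing for every index a
  radius with small quotient, where there is one, shows that one index has large quotients at all
  radii at once. Its neighbourhoods then outgrow the space left by the other sets.\<close>

lemma isoperimetric_constant_le:
  assumes m: "prob_space m" "sets m = sets borel"
    and A: "\<And>\<alpha>. \<alpha> \<le> k \<Longrightarrow> A \<alpha> \<in> sets borel" "\<And>\<alpha>. \<alpha> \<le> k \<Longrightarrow> measure m (A \<alpha>) > 0"
    and D: "D > 0" "\<And>\<alpha> \<beta>. \<alpha> \<le> k \<Longrightarrow> \<beta> \<le> k \<Longrightarrow> \<alpha> \<noteq> \<beta> \<Longrightarrow> ennreal D \<le> set_distance \<A> g (A \<alpha>) (A \<beta>)"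
    and L: "L > 0" "\<And>\<alpha>. \<alpha> \<le> k \<Longrightarrow>
      1 - (\<Sum>\<beta>\<in>{..k} - {\<alpha>}. measure m (A \<beta>)) < measure m (A \<alpha>) * exp L"
  shows "isoperimetric_constant \<A> g m k \<le> ereal (2 * L / D)"
proof (rule ccontr)
  interpret prob_space m by fact
  define c\<^sub>0 where "c\<^sub>0 = 2 * L / D"
  have c\<^sub>0: "c\<^sub>0 > 0" using D(1) L(1) by (simp add: c\<^sub>0_def)
  let ?U = "\<lambda>\<alpha> r. nbhd \<A> g r (A \<alpha>)"
  let ?q = "\<lambda>B. boundary_measure \<A> g m B / ereal (measure m B)"
  assume "\<not> isoperimetric_constant \<A> g m k \<le> ereal (2 * L / D)"
  then obtain c' where c': "c\<^sub>0 < c'" "ereal c' < isoperimetric_constant \<A> g m k"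
    using ereal_dense2[of "ereal c\<^sub>0"] by (auto simp: c\<^sub>0_def not_le)
  obtain c where c: "c\<^sub>0 < c" "c < c'" using dense[OF c'(1)] by blast
  have disj: "?U \<alpha> r \<inter> ?U \<beta> s = {}"
    if "\<alpha> \<le> k" "\<beta> \<le> k" "\<alpha> \<noteq> \<beta>" "r \<in> {0<..D/2}" "s \<in> {0<..D/2}" for \<alpha> \<beta> r s
  proof (rule nbhd_disjoint)
    have "ennreal (r + s) \<le> ennreal D" using that by (intro ennreal_leI) auto
    then show "ennreal (r + s) \<le> set_distance \<A> g (A \<alpha>) (A \<beta>)"
      using D(2)[OF that(1-3)] by simp
  qed (use that in auto)
  have meas: "?U \<alpha> r \<in> sets borel" for \<alpha> r using open_nbhd by (simp add: borel_open)
  have le: "measure m (A \<alpha>) \<le> measure m (?U \<alpha> r)" if "r > 0" for \<alpha> r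
    by (rule finite_measure_mono[OF subset_nbhd[OF that]]) (use m(2) meas in simp)
  have "\<exists>\<alpha>\<le>k. \<forall>r\<in>{0<..<D/2}. ereal c' < ?q (?U \<alpha> r)"
  proof (rule ccontr)
    assume "\<not> ?thesis"
    then have "\<forall>\<alpha>. \<exists>r. \<alpha> \<le> k \<longrightarrow> r \<in> {0<..<D/2} \<and> ?q (?U \<alpha> r) \<le> ereal c'"
      unfolding not_less[symmetric] by blast
    from choice[OF this] obtain r where
      r: "\<And>\<alpha>. \<alpha> \<le> k \<Longrightarrow> r \<alpha> \<in> {0<..<D/2} \<and> ?q (?U \<alpha> (r \<alpha>)) \<le> ereal c'"
      by blast
    have "isoperimetric_constant \<A> g m k \<le> (MAX \<alpha>\<in>{..k}. ?q (?U \<alpha> (r \<alpha>)))"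
      unfolding isoperimetric_constant_def
    proof (rule INF_lower, intro CollectI conjI allI impI)
      fix \<alpha> assume \<alpha>: "\<alpha> \<le> k"
      show "?U \<alpha> (r \<alpha>) \<in> sets borel" by (rule meas)
      show "0 < measure m (?U \<alpha> (r \<alpha>))"
        using le[of "r \<alpha>" \<alpha>] A(2)[OF \<alpha>] r[OF \<alpha>] by simp
      then show "?U \<alpha> (r \<alpha>) \<noteq> {}" by auto
    next
      show "disjoint_family_on (\<lambda>\<alpha>. ?U \<alpha> (r \<alpha>)) {..k}"
        unfolding disjoint_family_on_def
      proof (intro ballI impI)
        fix \<alpha> \<beta> assume "\<alpha> \<in> {..k}" "\<beta> \<in> {..k}" "\<alpha> \<noteq> \<beta>"
        then show "?U \<alpha> (r \<alpha>) \<inter> ?U \<beta> (r \<beta>) = {}"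
          using r[of \<alpha>] r[of \<beta>] by (intro disj) auto
      qed
    qed
    also have "\<dots> \<le> ereal c'" using r by (subst Max_le_iff) auto
    finally show False using c'(2) by simp
  qed
  then obtain \<alpha> where \<alpha>: "\<alpha> \<le> k" "\<And>r. r \<in> {0<..<D/2} \<Longrightarrow> ereal c' < ?q (?U \<alpha> r)" by blast
  \<comment> \<open>Growing at rate \<open>c > 2 L / D\<close> takes a time \<open>l < D / 2\<close> to gain the factor \<open>exp L\<close>; start at
    \<open>b - l > 0\<close> and stop at \<open>b < D / 2\<close>.\<close>
  define l where "l = L / c"
  define b where "b = (l + D / 2) / 2"
  have "c > 0" using c c\<^sub>0 by simp
  have "L < c * (D / 2)" using c(1) D(1) by (simp add: c\<^sub>0_def field_simps)
  then have l: "0 < l" "l < D / 2" using \<open>c > 0\<close> L(1) by (auto simp: l_def field_simps)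
  have b: "l < b" "b < D / 2" using l by (auto simp: b_def)
  have "measure m (A \<alpha>) * exp (c * (b - (b - l))) \<le> measure m (?U \<alpha> b)"
    by (rule measure_nbhd_growth[OF finite_measure_axioms m(2) A(2)[OF \<alpha>(1)] _ _ \<open>c > 0\<close> c(2)])
       (use \<alpha>(2) l b in auto)
  also have "c * (b - (b - l)) = L" using \<open>c > 0\<close> by (simp add: l_def)
  also have "measure m (?U \<alpha> b) \<le> 1 - (\<Sum>\<beta>\<in>{..k} - {\<alpha>}. measure m (A \<beta>))"
  proof (rule prob_le_one_minus_disjoint_union)
    \<comment> \<open>The radius \<open>D / 2\<close> is still allowed in \<open>disj\<close>, so the other sets, being contained in their
      neighbourhoods of that radius, avoid \<open>U\<^sub>b(A\<^sub>\<alpha>)\<close>.\<close>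
    have half: "A \<beta> \<subseteq> ?U \<beta> (D / 2)" for \<beta> using D(1) by (intro subset_nbhd) simp
    show "A \<beta> \<inter> ?U \<alpha> b = {}" if "\<beta> \<in> {..k} - {\<alpha>}" for \<beta>
      using disj[of \<beta> \<alpha> "D / 2" b] half[of \<beta>] that \<alpha>(1) D(1) l b by auto
    show "disjoint_family_on A ({..k} - {\<alpha>})"
      unfolding disjoint_family_on_def
    proof (intro ballI impI)
      fix \<beta> \<beta>' assume "\<beta> \<in> {..k} - {\<alpha>}" "\<beta>' \<in> {..k} - {\<alpha>}" "\<beta> \<noteq> \<beta>'"
      then show "A \<beta> \<inter> A \<beta>' = {}"
        using disj[of \<beta> \<beta>' "D / 2" "D / 2"] half[of \<beta>] half[of \<beta>'] D(1) by auto
    qed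
  qed (use A(1) m(2) meas in auto)
  also have "\<dots> < measure m (A \<alpha>) * exp L" by (rule L(2)[OF \<alpha>(1)])
  finally show False by simp
qed

end

lemma weighted_measure_prob_space:
  assumes "closed_weighted_riemannian_manifold \<A> g v f"
  shows "prob_space (weighted_measure v f)" and "sets (weighted_measure v f) = sets borel"
proof -
  have int: "(\<integral>x. exp (- f x) \<partial>v) = 1" and v: "sets v = sets borel"
    using assms by (auto simp: closed_weighted_riemannian_manifold_def riemannian_volume_def)
  have i: "integrable v (\<lambda>x. exp (- f x))" 
  proof (rule ccontr)
    assume "\<not> integrable v (\<lambda>x. exp (- f x))"
    then show False using int by (simp add: not_integrable_integral_eq)
  qed
  then have [measurable]: "(\<lambda>x. exp (- f x)) \<in> borel_measurable v" by auto
  show "sets (weighted_measure v f) = sets borel" using v by (simp add: weighted_measure_def)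
  have "emeasure (weighted_measure v f) (space v) = (\<integral>\<^sup>+x. ennreal (exp (- f x)) \<partial>v)"
    unfolding weighted_measure_def by (subst emeasure_density) (auto intro!: nn_integral_cong)
  also have "\<dots> = 1" using nn_integral_eq_integral[OF i] int by simp
  finally show "prob_space (weighted_measure v f)"
    by (intro prob_spaceI) (simp add: weighted_measure_def)
qed

lemma separation_le:
  assumes "\<alpha> \<le> k" "\<beta> \<le> k" "\<alpha> \<noteq> \<beta>"
  shows "separation \<A> g k A \<le> set_distance \<A> g (A \<alpha>) (A \<beta>)"
proof -
  have "finite {(\<alpha>, \<beta>). \<alpha> \<le> k \<and> \<beta> \<le> k \<and> \<alpha> \<noteq> \<beta>}"
    by (rule finite_subset[of _ "{..k} \<times> {..k}"]) auto
  then show ?thesis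
    unfolding separation_def by (intro Min_le) (use assms in auto)
qed

text \<open>An infinite separation is covered by letting \<open>D\<close> tend to infinity. The factor \<open>e\<close> inside the
  logarithm supplies the strict inequality in the hypothesis on \<open>L\<close>, as well as \<open>L > 0\<close>.\<close>

theorem theorem5p4:
  fixes \<A> :: "('a::{t2_space, second_countable_topology}, 'n::finite) chart set"
    and g :: "('a, 'n) metric"
    and v :: "'a measure"
    and f :: "'a \<Rightarrow> real"
    and k :: nat
    and A :: "nat \<Rightarrow> 'a set"
  assumes "closed_weighted_riemannian_manifold \<A> g v f"
    and "k \<ge> 1"
    and "\<forall>\<alpha>\<le>k. A \<alpha> \<in> sets borel"
  defines "m \<equiv> weighted_measure v f"
  shows "isoperimetric_constant \<A> g m k \<le>
    (if separation \<A> g k A = 0 \<or> (\<exists>\<alpha>\<le>k. measure m (A \<alpha>) = 0) then \<infinity>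
     else 2 / enn2ereal (separation \<A> g k A) *
       ereal (MAX \<alpha>\<in>{..k}.
         ln (exp 1 * (1 - (\<Sum>\<beta>\<in>{..k} - {\<alpha>}. measure m (A \<beta>))) / measure m (A \<alpha>))))"
proof (cases "separation \<A> g k A = 0 \<or> (\<exists>\<alpha>\<le>k. measure m (A \<alpha>) = 0)")
  case False
  interpret riemannian_atlas \<A> g
    using assms(1) by unfold_locales (auto simp: closed_weighted_riemannian_manifold_def)
  have m: "prob_space m" "sets m = sets borel"
    using weighted_measure_prob_space[OF assms(1)] by (simp_all add: m_def)
  interpret prob_space m by fact
  let ?s = "separation \<A> g k A"
  define rest where "rest \<alpha> = 1 - (\<Sum>\<beta>\<in>{..k} - {\<alpha>}. measure m (A \<beta>))" for \<alpha>
  define L where "L = (MAX \<alpha>\<in>{..k}. ln (exp 1 * rest \<alpha> / measure m (A \<alpha>)))"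
  have pos: "measure m (A \<alpha>) > 0" if "\<alpha> \<le> k" for \<alpha>
    using False that by (simp add: zero_less_measure_iff)
  have disj: "A \<alpha> \<inter> A \<beta> = {}" if "\<alpha> \<le> k" "\<beta> \<le> k" "\<alpha> \<noteq> \<beta>" for \<alpha> \<beta>
  proof (rule ccontr)
    assume "A \<alpha> \<inter> A \<beta> \<noteq> {}"
    then obtain x where x: "x \<in> A \<alpha>" "x \<in> A \<beta>" by blast
    have "set_distance \<A> g (A \<alpha>) (A \<beta>) \<le> riemannian_dist \<A> g x x"
      unfolding set_distance_def by (rule INF_lower2[OF x(1) INF_lower[OF x(2)]])
    also have "\<dots> \<le> 0"
    proof (rule ennreal_le_epsilon)
      fix e :: real assume "e > 0"
      then show "riemannian_dist \<A> g x x \<le> 0 + ennreal e"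
        using riemannian_dist_refl_less[of e x] by (simp add: less_imp_le)
    qed
    finally have "?s \<le> 0" using separation_le[OF that, of \<A> g A] by (rule order_trans[rotated])
    then show False using False by simp
  qed
  have rest: "measure m (A \<alpha>) \<le> rest \<alpha>" if "\<alpha> \<le> k" for \<alpha>
    unfolding rest_def
  proof (rule prob_le_one_minus_disjoint_union)
    show "disjoint_family_on A ({..k} - {\<alpha>})"
      unfolding disjoint_family_on_def by (intro ballI impI disj) simp_all
    show "A \<beta> \<inter> A \<alpha> = {}" if "\<beta> \<in> {..k} - {\<alpha>}" for \<beta> 
      using that \<open>\<alpha> \<le> k\<close> by (intro disj) simp_all
  qed (use assms(3) m(2) that in auto)
  have ln_le: "ln (exp 1 * rest \<alpha> / measure m (A \<alpha>)) \<le> L" if "\<alpha> \<le> k" for \<alpha>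
    unfolding L_def by (rule Max_ge) (use that in auto)
  have exp_L: "rest \<alpha> < measure m (A \<alpha>) * exp L" if "\<alpha> \<le> k" for \<alpha>
  proof -
    have p: "measure m (A \<alpha>) > 0" "rest \<alpha> > 0" using pos[OF that] rest[OF that] by linarith+
    have "exp 1 * rest \<alpha> / measure m (A \<alpha>) = exp (ln (exp 1 * rest \<alpha> / measure m (A \<alpha>)))"
      by (rule exp_ln[symmetric]) (use p in simp)
    also have "\<dots> \<le> exp L" using ln_le[OF that] by simp
    finally have "exp 1 * rest \<alpha> \<le> measure m (A \<alpha>) * exp L"
      using p by (simp add: pos_divide_le_eq mult.commute)
    moreover have "1 * rest \<alpha> < exp 1 * rest \<alpha>" using p by (intro mult_strict_right_mono) simp_all
    ultimately show ?thesis by simp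
  qed
  have "measure m (A 0) * 1 < measure m (A 0) * exp L" using rest[of 0] exp_L[of 0] by simp
  then have L: "L > 0" using pos[of 0] by (simp only: mult_less_cancel_left_pos one_less_exp_iff)
  have bound: "isoperimetric_constant \<A> g m k \<le> ereal (2 * L / D)"
    if "D > 0" "ennreal D \<le> ?s" for D
  proof (rule isoperimetric_constant_le[where A=A, OF m _ pos that(1) _ L exp_L[unfolded rest_def]])
    show "ennreal D \<le> set_distance \<A> g (A \<alpha>) (A \<beta>)" if "\<alpha> \<le> k" "\<beta> \<le> k" "\<alpha> \<noteq> \<beta>" for \<alpha> \<beta>
      using \<open>ennreal D \<le> ?s\<close> separation_le[OF that] by (rule order_trans)
  qed (use assms(3) in simp)
  have "isoperimetric_constant \<A> g m k \<le> 2 / enn2ereal ?s * ereal L"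
  proof (cases ?s)
    case (real D)
    then have "D > 0" using False by (cases "D = 0") auto
    then show ?thesis using bound[of D] real by (simp add: enn2ereal_ennreal)
  next
    case top
    have "isoperimetric_constant \<A> g m k \<le> 0 + ereal e" if "e > 0" for e
      \<comment> \<open>The bound \<open>2 L / D\<close> equals \<open>e\<close> for \<open>D = 2 L / e\<close>.\<close>
      using bound[of "2 * L / e"] that L top by simp
    then have "isoperimetric_constant \<A> g m k \<le> 0" by (rule ereal_le_epsilon2[rule_format])
    then show ?thesis using top by simp
  qed
  then show ?thesis using False by (simp add: L_def rest_def)
qed simp

end
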